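(* For a positive integer $n\ge 3$, let $r=r(n)\ge 3$ be an integer such that $r$ divides $n$ for infinitely many values of $n$, and let $n\to\infty$ along these values. Let $k=k(n)\ge 2$ be an integer and let $Z$ denote the number of perfect matchings in a hypergraph chosen uniformly at random from $\mathcal{H}_r(k,n)$. Then, when $r^4k^2=o(n)$, \[ \mathbb{E}(Z)=\sqrt{r}\left(k\left(\frac{k-1}{k}\right)^{(r-1)(k-1)}\right)^{n/r}\exp\left(\frac{r-1}{2}+O\left(\frac{r^4k^2}{n}\right)\right). \]
   Context: A simple $r$-uniform hypergraph on the vertex set $V=\{v_1,\ldots,v_n\}$ is a set of $r$-element subsets of $V$ (its edges); no loops and no repeated edges are allowed. $\mathcal{H}_r(k,n)$ is the set of all simple $r$-uniform hypergraphs on $V$ in which every vertex has degree $k$. When $r$ divides $n$, a perfect matching in $H\in\mathcal{H}_r(k,n)$ is a set of $n/r$ edges of $H$ which covers every vertex exactly once. All asymptotics are as $n\to\infty$ along values of $n$ divisible by $r$. *)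

theory Defs
  imports "HOL-Probability.Probability" "HOL-Library.Landau_Symbols"
begin

text \<open>A simple hypergraph on \<open>V\<close> is identified with its set of edges, so repeated edges cannot
  occur, and since an edge is a set, neither can loops.\<close>

definition uniform_hypergraph :: "'a set \<Rightarrow> nat \<Rightarrow> 'a set set \<Rightarrow> bool" where
  "uniform_hypergraph V r H \<longleftrightarrow> (\<forall>e\<in>H. e \<subseteq> V \<and> card e = r)"

definition hyper_degree :: "'a set set \<Rightarrow> 'a \<Rightarrow> nat" where
  "hyper_degree H v = card {e \<in> H. v \<in> e}"

text \<open>The set \<open>\<H>\<^sub>r(k,n)\<close>, with vertex set \<open>{1..n}\<close>.\<close>

definition regular_hypergraphs :: "nat \<Rightarrow> nat \<Rightarrow> nat \<Rightarrow> nat set set set" where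
  "regular_hypergraphs r k n =
     {H. uniform_hypergraph {1..n} r H \<and> (\<forall>v\<in>{1..n}. hyper_degree H v = k)}"

text \<open>Only meaningful when \<open>r\<close> divides the number of vertices, so that \<open>card V div r\<close> is exact.\<close>

definition perfect_matching :: "'a set \<Rightarrow> nat \<Rightarrow> 'a set set \<Rightarrow> 'a set set \<Rightarrow> bool" where
  "perfect_matching V r H M \<longleftrightarrow>
     M \<subseteq> H \<and> card M = card V div r \<and> (\<forall>v\<in>V. \<exists>!e. e \<in> M \<and> v \<in> e)"

definition num_perfect_matchings :: "'a set \<Rightarrow> nat \<Rightarrow> 'a set set \<Rightarrow> nat" where
  "num_perfect_matchings V r H = card {M. perfect_matching V r H M}"

definition expected_perfect_matchings :: "nat \<Rightarrow> nat \<Rightarrow> nat \<Rightarrow> real" where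
  "expected_perfect_matchings r k n =
     measure_pmf.expectation (pmf_of_set (regular_hypergraphs r k n))
       (\<lambda>H. real (num_perfect_matchings {1..n} r H))"

text \<open>The filter for \<open>n \<rightarrow> \<infinity>\<close> along those \<open>n\<close> that are divisible by \<open>r(n)\<close>.\<close>

definition at_top_divisible :: "(nat \<Rightarrow> nat) \<Rightarrow> nat filter" where
  "at_top_divisible r = inf at_top (principal {n. r n dvd n})"

end

theory Submission
  imports Defs "HOL-Combinatorics.Multiset_Permutations"
begin

text \<open>
  Write \<open>k = d + 1\<close>, \<open>n = q r\<close>. Counting pairs of a hypergraph and a perfect matching contained in it
  expresses the expectation through the number of \<open>k\<close>-regular hypergraphs and the number of
  \<open>d\<close>-regular hypergraphs avoiding a given matching. Up to the orderings of the edges and of the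
  vertices within an edge, a \<open>d\<close>-regular hypergraph is a word of length \<open>d n\<close> in which every vertex
  occurs \<open>d\<close> times, whose consecutive blocks of length \<open>r\<close> have no repeated letter and have pairwise
  distinct letter sets.

  The probability that a random word has no repetition inside a block may be exponentially small.
  It is computed by imposing the conditions \<open>w a \<noteq> w b\<close> one pair of positions at a time. Given the
  conditions already imposed, swapping the letter at position \<open>b\<close> with the letter at a random position
  shows that \<open>w a = w b\<close> has probability \<open>(d - 1) / (d n) + O(r / n\<^sup>2)\<close>; the product over all
  \<open>d n (r - 1) / 2\<close> pairs is \<open>exp (- (r - 1) (d - 1) / 2 + O(d r\<^sup>2 / n))\<close>. The same switching shows that,
  conditionally, two blocks coincide or some block is an edge of the matching only with probability
  \<open>O(d\<^sup>2 r / n)\<close>. The ratio of the numbers for \<open>d\<close> and \<open>k\<close> then yields the factor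
  \<open>exp ((r - 1) / 2)\<close>, and Stirling's formula does the rest.
\<close>

section \<open>Words in which every letter occurs equally often\<close>

definition words :: "'a set \<Rightarrow> nat \<Rightarrow> nat \<Rightarrow> (nat \<Rightarrow> 'a) set" where
  "words V d N = {w \<in> {..<N} \<rightarrow>\<^sub>E V. \<forall>v\<in>V. card {c. c < N \<and> w c = v} = d}"

lemma finite_words: "finite V \<Longrightarrow> finite (words V d N)"
  unfolding words_def by (rule finite_subset[of _ "{..<N} \<rightarrow>\<^sub>E V"]) (auto intro: finite_PiE)

lemma count_mset_map_upt: "count (mset (map w [0..<N])) v = card {c. c < N \<and> w c = v}"
proof -
  have "count (mset (map w [0..<N])) v = length (filter ((=) v) (map w [0..<N]))"
    by (simp only: count_mset count_list_eq_length_filter)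
  also have "\<dots> = card {i. i < length (map w [0..<N]) \<and> v = map w [0..<N] ! i}"
    by (rule length_filter_conv_card)
  also have "{i. i < length (map w [0..<N]) \<and> v = map w [0..<N] ! i} = {c. c < N \<and> w c = v}"
    by auto
  finally show ?thesis .
qed

text \<open>The words are the orderings of the multiset that contains every vertex \<open>d\<close>
  times, so their number is a multinomial coefficient. The product form avoids division of
  naturals.\<close>

lemma card_words:
  assumes V: "finite V" and N: "N = d * card V"
  shows "card (words V d N) * fact d ^ card V = fact N"
proof -
  define A where "A = (\<Sum>v\<in>V. replicate_mset d v)"
  have cnt: "count A v = (if v \<in> V then d else 0)" for v
    using V by (simp add: A_def count_sum)
  have szA: "size A = N"
    by (simp add: A_def N)
  have setA: "set_mset A \<subseteq> V"
  proof
    fix v assume "v \<in># A"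
    then have "count A v \<noteq> 0" by simp
    then show "v \<in> V" by (auto simp: cnt split: if_splits)
  qed
  have bij: "bij_betw (\<lambda>w. map w [0..<N]) (words V d N) (permutations_of_multiset A)"
  proof (rule bij_betw_byWitness[where f' = "\<lambda>xs. \<lambda>i\<in>{..<N}. xs ! i"])
    show "\<forall>w\<in>words V d N. (\<lambda>i\<in>{..<N}. map w [0..<N] ! i) = w"
    proof
      fix w assume "w \<in> words V d N"
      then have "w \<in> extensional {..<N}" by (simp add: words_def PiE_def)
      then show "(\<lambda>i\<in>{..<N}. map w [0..<N] ! i) = w"
        by (intro ext) (simp add: extensional_def)
    qed
    show "\<forall>xs\<in>permutations_of_multiset A. map (\<lambda>i\<in>{..<N}. xs ! i) [0..<N] = xs"
      by (auto simp: permutations_of_multiset_def szA[symmetric] intro!: nth_equalityI)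
    show "(\<lambda>w. map w [0..<N]) ` words V d N \<subseteq> permutations_of_multiset A"
    proof
      fix xs assume "xs \<in> (\<lambda>w. map w [0..<N]) ` words V d N"
      then obtain w where w: "w \<in> words V d N" "xs = map w [0..<N]" by blast
      have "count (mset xs) v = count A v" for v
      proof (cases "v \<in> V")
        case True
        then show ?thesis using w by (simp add: w(2) count_mset_map_upt cnt words_def del: mset_map)
      next
        case False
        then have "{c. c < N \<and> w c = v} = {}" using w by (auto simp: words_def)
        then show ?thesis using False w by (simp only: w(2) count_mset_map_upt cnt) simp
      qed
      then show "xs \<in> permutations_of_multiset A"
        by (simp add: permutations_of_multiset_def multiset_eqI)
    qed
    show "(\<lambda>xs. \<lambda>i\<in>{..<N}. xs ! i) ` permutations_of_multiset A \<subseteq> words V d N"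
    proof
      fix w assume "w \<in> (\<lambda>xs. \<lambda>i\<in>{..<N}. xs ! i) ` permutations_of_multiset A"
      then obtain xs where xs: "mset xs = A" "w = (\<lambda>i\<in>{..<N}. xs ! i)"
        by (auto simp: permutations_of_multiset_def)
      have len: "length xs = N" using xs(1) szA by (metis size_mset)
      have eq: "map w [0..<N] = xs"
        using len by (auto intro!: nth_equalityI simp: xs(2))
      have "w \<in> {..<N} \<rightarrow>\<^sub>E V"
        using setA xs len by (auto simp: xs(2) subset_iff) 
      moreover have "card {c. c < N \<and> w c = v} = d" if "v \<in> V" for v
        using count_mset_map_upt[of w N v] cnt[of v] that by (simp only: eq xs(1)) simp
      ultimately show "w \<in> words V d N" by (simp add: words_def)
    qed
  qed
  have "card (permutations_of_multiset A) * (\<Prod>x\<in>set_mset A. fact (count A x)) = fact (size A)"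
    by (rule card_permutations_of_multiset_aux)
  moreover have "(\<Prod>x\<in>set_mset A. fact (count A x)) = (\<Prod>x\<in>V. fact (count A x) :: nat)"
    by (rule prod.mono_neutral_left) (use V setA in \<open>auto simp: not_in_iff\<close>)
  moreover have "(\<Prod>x\<in>V. fact (count A x) :: nat) = fact d ^ card V"
    by (simp add: cnt)
  ultimately show ?thesis
    using bij_betw_same_card[OF bij] by (simp add: szA)
qed

section \<open>Swapping letters under forbidden coincidences\<close>

definition avoiding :: "'a set \<Rightarrow> nat \<Rightarrow> nat \<Rightarrow> nat set set \<Rightarrow> (nat \<Rightarrow> 'a) set" where
  "avoiding V d N G = {w \<in> words V d N. \<forall>a b. {a, b} \<in> G \<longrightarrow> w a \<noteq> w b}"

definition conflict_graph :: "nat \<Rightarrow> nat \<Rightarrow> nat set set \<Rightarrow> bool" where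
  "conflict_graph N \<Delta> G \<longleftrightarrow>
     (\<forall>e\<in>G. e \<subseteq> {..<N} \<and> card e = 2) \<and> (\<forall>b. card {c. {b, c} \<in> G} \<le> \<Delta>)"

text \<open>Taking \<open>x = b\<close> in the first condition shows that a neighbour
  \<open>c\<close> of \<open>b\<close> is never swappable with it, so the two exchanged letters need
  not be compared with each other.\<close>

definition swappable :: "nat set set \<Rightarrow> (nat \<Rightarrow> 'a) \<Rightarrow> nat \<Rightarrow> nat \<Rightarrow> bool" where
  "swappable G w b c \<longleftrightarrow>
     (\<forall>x. {c, x} \<in> G \<longrightarrow> w x \<noteq> w b) \<and> (\<forall>x. {b, x} \<in> G \<longrightarrow> w x \<noteq> w c)"

text \<open>For the same \<open>c\<close> the map \<open>h\<close> undoes itself, so the pairs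
  counted over \<open>A\<close> embed into the pairs counted over \<open>B\<close>.\<close>

lemma switching_double_count:
  assumes "finite A" "finite B"
    and "\<And>x. x \<in> A \<Longrightarrow> s \<le> card (S x)" "\<And>x. x \<in> A \<Longrightarrow> finite (S x)"
    and "\<And>y. y \<in> B \<Longrightarrow> card (T y) \<le> t" "\<And>y. y \<in> B \<Longrightarrow> finite (T y)"
    and "\<And>x c. x \<in> A \<Longrightarrow> c \<in> S x \<Longrightarrow> h x c \<in> B \<and> c \<in> T (h x c) \<and> h (h x c) c = x"
  shows "card A * s \<le> card B * t"
proof -
  have "card A * s \<le> (\<Sum>x\<in>A. card (S x))"
    using sum_bounded_below[of A s "\<lambda>x. card (S x)"] assms(3) by simp
  also have "\<dots> = card (SIGMA x:A. S x)"
    using assms(1,4) by simp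
  also have "\<dots> \<le> card (SIGMA y:B. T y)"
  proof (rule card_inj_on_le[where f = "\<lambda>(x, c). (h x c, c)"])
    show "inj_on (\<lambda>(x, c). (h x c, c)) (SIGMA x:A. S x)"
      by (rule inj_on_inverseI[where g = "\<lambda>(y, c). (h y c, c)"]) (use assms(7) in auto)
    show "(\<lambda>(x, c). (h x c, c)) ` (SIGMA x:A. S x) \<subseteq> (SIGMA y:B. T y)"
      using assms(7) by auto
    show "finite (SIGMA y:B. T y)" using assms(2,6) by simp
  qed
  also have "\<dots> = (\<Sum>y\<in>B. card (T y))"
    using assms(2,6) by simp
  also have "\<dots> \<le> card B * t"
    using sum_bounded_above[of B "\<lambda>x. card (T x)" t] assms(5) by simp
  finally show ?thesis .
qed

lemma swap_words:
  assumes "w \<in> words V d N" "b < N" "c < N"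
  shows "w \<circ> Transposition.transpose b c \<in> words V d N"
proof -
  have tr: "Transposition.transpose b c x < N \<longleftrightarrow> x < N" for x
    using assms by (auto simp: Transposition.transpose_def)
  have "card {x. x < N \<and> (w \<circ> Transposition.transpose b c) x = v} = card {x. x < N \<and> w x = v}" for v
  proof (rule bij_betw_same_card)
    show "bij_betw (Transposition.transpose b c) {x. x < N \<and> (w \<circ> Transposition.transpose b c) x = v} {x. x < N \<and> w x = v}"
      by (rule bij_betw_byWitness[where f' = "Transposition.transpose b c"]) (auto simp: tr)
  qed
  moreover have "w \<circ> Transposition.transpose b c \<in> {..<N} \<rightarrow>\<^sub>E V"
    using assms tr by (auto simp: words_def PiE_def extensional_def Transposition.transpose_def)
  ultimately show ?thesis using assms by (simp add: words_def)
qed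

text \<open>Only conflict edges meeting \<open>b\<close> or \<open>c\<close> see different letters
  after the swap, and the two halves of \<open>swappable\<close> cover these.\<close>

lemma swap_avoiding:
  assumes "w \<in> avoiding V d N G" "conflict_graph N \<Delta> G" "b < N" "c < N" "swappable G w b c"
  shows "w \<circ> Transposition.transpose b c \<in> avoiding V d N G"
proof -
  have "w (Transposition.transpose b c x) \<noteq> w (Transposition.transpose b c y)" if e: "{x, y} \<in> G" for x y
  proof -
    have xy: "x \<noteq> y" using e assms(2) by (force simp: conflict_graph_def)
    have e': "{y, x} \<in> G" using e by (simp add: insert_commute)
    have "w x \<noteq> w y" using e assms(1) by (simp add: avoiding_def)
    moreover have "{b, c} \<notin> G" "{c, b} \<notin> G"
      using assms(5) by (auto simp: swappable_def insert_commute)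
    moreover have "w x' \<noteq> w b" if "{c, x'} \<in> G" for x'
      using assms(5) that by (simp add: swappable_def)
    moreover have "w x' \<noteq> w c" if "{b, x'} \<in> G" for x'
      using assms(5) that by (simp add: swappable_def)
    ultimately show ?thesis
      using e e' xy by (cases "x = b"; cases "x = c"; cases "y = b"; cases "y = c") (simp_all, metis+)
  qed
  then show ?thesis
    using assms swap_words by (auto simp: avoiding_def)
qed

lemma finite_avoiding: "finite V \<Longrightarrow> finite (avoiding V d N G)"
  unfolding avoiding_def by (simp add: finite_words)

lemma avoiding_subset_words: "avoiding V d N G \<subseteq> words V d N"
  by (auto simp: avoiding_def)

lemma words_in: "w \<in> words V d N \<Longrightarrow> c < N \<Longrightarrow> w c \<in> V"
  by (auto simp: words_def)

lemma card_word_preimage: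
  assumes "w \<in> words V d N" "R \<subseteq> V" "finite R"
  shows "card {c. c < N \<and> w c \<in> R} = card R * d"
proof -
  have "{c. c < N \<and> w c \<in> R} = (\<Union>v\<in>R. {c. c < N \<and> w c = v})" by auto
  also have "card \<dots> = (\<Sum>v\<in>R. card {c. c < N \<and> w c = v})"
    by (rule card_UN_disjoint) (use assms in auto)
  also have "\<dots> = (\<Sum>v\<in>R. d)"
    by (rule sum.cong) (use assms in \<open>auto simp: words_def\<close>)
  finally show ?thesis by simp
qed

lemma card_UN_bound:
  assumes "finite I" "\<And>i. i \<in> I \<Longrightarrow> card (A i) \<le> m"
  shows "card (\<Union>i\<in>I. A i) \<le> card I * m"
  using card_UN_le[OF assms(1), of A] sum_bounded_above[of I "\<lambda>i. card (A i)" m] assms(2)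
  by fastforce

section \<open>Switching\<close>

text \<open>The graph records the inequalities already imposed. The bound
  \<open>100 * \<Delta> \<le> card V\<close> makes the positions lost in a switching a small
  fraction of all \<open>N\<close>.\<close>

locale conflict_model =
  fixes V :: "'a set" and d N \<Delta> :: nat and G :: "nat set set"
  assumes fin: "finite V" and N_eq: "N = d * card V" and graph: "conflict_graph N \<Delta> G"
    and d_pos: "1 \<le> d" and \<Delta>_ge: "2 \<le> \<Delta>" and large: "100 * \<Delta> \<le> card V"
begin

abbreviation F where "F \<equiv> avoiding V d N G"

lemma fin_F: "finite F" using fin by (rule finite_avoiding)

lemma nbrs: "{c. {b, c} \<in> G} \<subseteq> {..<N}" "finite {c. {b, c} \<in> G}" "card {c. {b, c} \<in> G} \<le> \<Delta>"
proof -
  show "{c. {b, c} \<in> G} \<subseteq> {..<N}" using graph by (auto simp: conflict_graph_def)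
  then show "finite {c. {b, c} \<in> G}" using finite_subset by blast
  show "card {c. {b, c} \<in> G} \<le> \<Delta>" using graph by (auto simp: conflict_graph_def)
qed

lemma edge_neq: "{b, c} \<in> G \<Longrightarrow> b \<noteq> c"
  using graph by (force simp: conflict_graph_def)

text \<open>A bad \<open>c\<close> is adjacent to one of the \<open>d\<close> positions carrying
  \<open>w b\<close>, or carries the letter of one of the at most \<Delta> neighbours of
  \<open>b\<close>. Each kind accounts for at most \<open>d * \<Delta>\<close> positions.\<close>

lemma card_not_swappable:
  assumes w: "w \<in> words V d N" and b: "b < N"
  shows "card {c. c < N \<and> \<not> swappable G w b c} \<le> 2 * d * \<Delta>"
proof -
  let ?A = "\<Union>x\<in>{x. x < N \<and> w x \<in> {w b}}. {c. {x, c} \<in> G}"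
  let ?B = "\<Union>x\<in>{x. {b, x} \<in> G}. {c. c < N \<and> w c \<in> {w x}}"
  have "card {x. x < N \<and> w x \<in> {w b}} = d"
    using card_word_preimage[OF w, of "{w b}"] words_in[OF w b] by simp
  then have A: "card ?A \<le> d * \<Delta>"
    using card_UN_bound[of "{x. x < N \<and> w x \<in> {w b}}" "\<lambda>x. {c. {x, c} \<in> G}" \<Delta>] nbrs(3) by simp
  have "card {c. c < N \<and> w c \<in> {w x}} \<le> d" if "{b, x} \<in> G" for x
  proof -
    have "x < N" using that nbrs(1)[of b] by auto
    then show ?thesis
      using card_word_preimage[OF w, of "{w x}"] words_in[OF w] by simp
  qed
  then have "card ?B \<le> card {x. {b, x} \<in> G} * d"
    by (intro card_UN_bound) (use nbrs(2) in auto)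
  also have "\<dots> \<le> \<Delta> * d" using nbrs(3) by (intro mult_right_mono) auto
  finally have B: "card ?B \<le> d * \<Delta>" by (simp add: mult.commute)
  have finAB: "finite (?A \<union> ?B)" using nbrs(2) by auto
  have "{c. c < N \<and> \<not> swappable G w b c} \<subseteq> ?A \<union> ?B"
  proof
    fix c assume "c \<in> {c. c < N \<and> \<not> swappable G w b c}"
    then have c: "c < N" "(\<exists>x. {c, x} \<in> G \<and> w x = w b) \<or> (\<exists>x. {b, x} \<in> G \<and> w x = w c)"
      by (auto simp: swappable_def)
    from c(2) show "c \<in> ?A \<union> ?B"
    proof
      assume "\<exists>x. {c, x} \<in> G \<and> w x = w b"
      then obtain x where x: "{c, x} \<in> G" "w x = w b" by blast
      then have "x < N" "{x, c} \<in> G" using nbrs(1)[of c] by (auto simp: insert_commute)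
      then show ?thesis using x by blast
    next
      assume "\<exists>x. {b, x} \<in> G \<and> w x = w c"
      then show ?thesis using c(1) by (metis (mono_tags, lifting) UN_iff UnCI mem_Collect_eq singletonI)
    qed
  qed
  then have "card {c. c < N \<and> \<not> swappable G w b c} \<le> card (?A \<union> ?B)"
    using finAB card_mono by blast
  also have "\<dots> \<le> card ?A + card ?B" by (rule card_Un_le)
  finally show ?thesis using A B by simp
qed

text \<open>Here \<open>P\<close> and \<open>R\<close> depend only on the positions in \<open>Q\<close>. The bound comes from swapping the
  letter at \<open>b\<close> with the letter at a position \<open>c\<close> outside \<open>Q\<close>: most \<open>c\<close> create no conflict, and the
  swap can be undone only at positions carrying a letter of \<open>R w\<close>.\<close>

lemma switch_bound:
  assumes b: "b < N" "b \<notin> Q" and Q: "finite Q"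
    and loc: "\<And>w w'. (\<And>x. x \<in> Q \<Longrightarrow> w x = w' x) \<Longrightarrow> P w = P w' \<and> R w = R w'"
    and t: "\<And>w. w \<in> F \<Longrightarrow> P w \<Longrightarrow> card {c. c < N \<and> c \<notin> Q \<and> w c \<in> R w} \<le> t"
  shows "card {w \<in> F. P w \<and> w b \<in> R w} * (N - 2 * d * \<Delta> - card Q) \<le> card {w \<in> F. P w} * t"
proof (rule switching_double_count[where
      S = "\<lambda>w. {c. c < N \<and> c \<notin> Q \<and> swappable G w b c}" and
      T = "\<lambda>w. {c. c < N \<and> c \<notin> Q \<and> w c \<in> R w}" and
      h = "\<lambda>w c. w \<circ> Transposition.transpose b c"])
  show "finite {w \<in> F. P w \<and> w b \<in> R w}" "finite {w \<in> F. P w}" using fin_F by auto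
  fix w assume w: "w \<in> {w \<in> F. P w \<and> w b \<in> R w}"
  then have ww: "w \<in> words V d N" using avoiding_subset_words by blast
  have "{..<N} - {c. c < N \<and> \<not> swappable G w b c} - Q \<subseteq> {c. c < N \<and> c \<notin> Q \<and> swappable G w b c}"
    by auto
  then have "card ({..<N} - {c. c < N \<and> \<not> swappable G w b c} - Q) \<le> card {c. c < N \<and> c \<notin> Q \<and> swappable G w b c}"
    by (intro card_mono) auto
  moreover have "card ({..<N} - {c. c < N \<and> \<not> swappable G w b c} - Q) \<ge> 
      card ({..<N} - {c. c < N \<and> \<not> swappable G w b c}) - card Q"
    by (rule diff_card_le_card_Diff) (use Q in auto)
  moreover have "card ({..<N} - {c. c < N \<and> \<not> swappable G w b c}) \<ge> card {..<N} - card {c. c < N \<and> \<not> swappable G w b c}"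
    by (rule diff_card_le_card_Diff) auto
  ultimately show "N - 2 * d * \<Delta> - card Q \<le> card {c. c < N \<and> c \<notin> Q \<and> swappable G w b c}"
    using card_not_swappable[OF ww b(1)] by simp
next
  fix w c assume w: "w \<in> {w \<in> F. P w \<and> w b \<in> R w}"
    and c: "c \<in> {c. c < N \<and> c \<notin> Q \<and> swappable G w b c}"
  let ?w = "w \<circ> Transposition.transpose b c"
  have "?w \<in> F" by (rule swap_avoiding[OF _ graph]) (use w c b in auto)
  \<comment> \<open>The swap moves only the letters at \<open>b\<close> and \<open>c\<close>, both
    outside \<open>Q\<close>.\<close>
  moreover have "P ?w = P w \<and> R ?w = R w"
    by (rule loc) (use b c in \<open>auto simp: Transposition.transpose_def\<close>)
  moreover have "?w \<circ> Transposition.transpose b c = w"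
    by (simp add: comp_assoc)
  ultimately show "?w \<in> {w \<in> F. P w} \<and> c \<in> {c. c < N \<and> c \<notin> Q \<and> ?w c \<in> R ?w} \<and>
       ?w \<circ> Transposition.transpose b c = w"
    using w c by auto
qed (use t in auto)

lemma N_pos: "0 < N" using N_eq d_pos large \<Delta>_ge by auto

lemma card_V_pos: "0 < card V" using large \<Delta>_ge by auto

lemma N_large: "100 * (d * \<Delta>) \<le> N" 
  using large mult_le_mono2[of "100 * \<Delta>" "card V" d] by (simp add: N_eq mult.assoc mult.left_commute)

lemma \<Delta>_le: "\<Delta> \<le> d * \<Delta>" using d_pos by simp

text \<open>The letters of \<open>R w\<close> fill at most \<open>s * d\<close> of the
  \<open>d * card V\<close> positions; the factor 2 pays for the unusable ones. The size allowed for
  \<open>Q\<close> leaves room for a block and two further positions.\<close>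

lemma switch_prob:
  assumes b: "b < N" "b \<notin> Q" and Q: "finite Q" "card Q \<le> \<Delta> + 2"
    and loc: "\<And>w w'. (\<And>x. x \<in> Q \<Longrightarrow> w x = w' x) \<Longrightarrow> P w = P w' \<and> R w = R w'"
    and t: "\<And>w. w \<in> F \<Longrightarrow> P w \<Longrightarrow> R w \<subseteq> V \<and> card (R w) \<le> s"
  shows "real (card {w \<in> F. P w \<and> w b \<in> R w}) \<le> 2 * real s / card V * card {w \<in> F. P w}"
proof -
  let ?x = "card {w \<in> F. P w \<and> w b \<in> R w}" and ?y = "card {w \<in> F. P w}"
  have "?x * (N - 2 * d * \<Delta> - card Q) \<le> ?y * (s * d)"
  proof (rule switch_bound[OF b Q(1) loc])
    fix w assume w: "w \<in> F" "P w"
    have "finite (R w)" using t[OF w] fin finite_subset by blast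
    have "card {c. c < N \<and> c \<notin> Q \<and> w c \<in> R w} \<le> card {c. c < N \<and> w c \<in> R w}"
      by (rule card_mono) auto
    also have "\<dots> = card (R w) * d"
      using w t[OF w] \<open>finite (R w)\<close> avoiding_subset_words by (intro card_word_preimage) blast+
    also have "\<dots> \<le> s * d" using t[OF w] by simp
    finally show "card {c. c < N \<and> c \<notin> Q \<and> w c \<in> R w} \<le> s * d" .
  qed
  \<comment> \<open>At most \<open>4 * d * \<Delta>\<close> positions are unusable, which is at most
    \<open>N / 25\<close>.\<close>
  moreover have "N \<le> 2 * (N - 2 * d * \<Delta> - card Q)"
    using N_large Q(2) \<Delta>_le \<Delta>_ge unfolding mult.assoc by linarith
  then have "?x * N \<le> ?x * (2 * (N - 2 * d * \<Delta> - card Q))" by (intro mult_left_mono) auto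
  ultimately have "?x * N \<le> 2 * (?y * (s * d))" by (simp add: algebra_simps)
  then have "real (?x * N) \<le> real (2 * (?y * (s * d)))" by (rule of_nat_mono)
  then have "real ?x * card V * d \<le> 2 * s * ?y * d" by (simp add: N_eq algebra_simps)
  then have "real ?x * card V \<le> 2 * s * ?y" using d_pos by simp
  then show ?thesis using card_V_pos by (simp add: field_simps)
qed

section \<open>Collision probability of a pair of positions\<close>

lemma pair_prob:
  assumes "a < N" "b < N" "a \<noteq> b"
  shows "real (card {w \<in> F. w b = w a}) \<le> 2 / card V * card F"
proof -
  have "real (card {w \<in> F. True \<and> w b \<in> {w a}}) \<le> 2 * real 1 / card V * card {w \<in> F. True}"
  proof (rule switch_prob[where Q = "{a}"])
    fix w assume "w \<in> F"
    then show "{w a} \<subseteq> V \<and> card {w a} \<le> 1"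
      using assms avoiding_subset_words words_in by fastforce
  qed (use assms in auto)
  then show ?thesis by simp
qed

text \<open>The event at \<open>c\<close> costs a factor \<open>2 / card V\<close>. Given this
  event, the switching at \<open>c'\<close>, with \<open>c\<close> among the protected positions,
  costs the same factor again.\<close>

lemma pair_pair_prob:
  assumes "a < N" "b < N" "c < N" "c' < N" and "distinct [a, b, c, c']"
  shows "real (card {w \<in> F. w c = w a \<and> w c' = w b}) \<le> 4 / (card V)\<^sup>2 * card F"
proof -
  have "real (card {w \<in> F. w c = w a \<and> w c' \<in> {w b}}) \<le> 2 * real 1 / card V * card {w \<in> F. w c = w a}"
  proof (rule switch_prob[where Q = "{a, b, c}"])
    fix w assume "w \<in> F"
    then show "{w b} \<subseteq> V \<and> card {w b} \<le> 1"
      using assms avoiding_subset_words words_in by fastforce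
  next
    show "card {a, b, c} \<le> \<Delta> + 2" using \<Delta>_ge by (auto simp: card_insert_if)
  qed (use assms in auto)
  also have "\<dots> \<le> 2 * real 1 / card V * (2 / card V * card F)"
    by (intro mult_left_mono pair_prob) (use assms in auto)
  finally show ?thesis by (simp add: power2_eq_square)
qed

text \<open>Since \<open>a\<close> is protected, only the other \<open>d - 1\<close> occurrences of
  its letter can undo a swap. This refines the factor \<open>d\<close> of \<open>pair_prob\<close>
  and yields the main term \<open>(d - 1) / N\<close>.\<close>

lemma collision_upper:
  assumes "a < N" "b < N" "a \<noteq> b"
  shows "card {w \<in> F. w b = w a} * (N - 2 * d * \<Delta> - 1) \<le> card F * (d - 1)"
proof -
  have "card {w \<in> F. True \<and> w b \<in> {w a}} * (N - 2 * d * \<Delta> - card {a}) \<le> card {w \<in> F. True} * (d - 1)"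
  proof (rule switch_bound)
    fix w assume w: "w \<in> F"
    then have w': "w \<in> words V d N" using avoiding_subset_words by blast
    have "{c. c < N \<and> c \<notin> {a} \<and> w c \<in> {w a}} = {c. c < N \<and> w c \<in> {w a}} - {a}" by auto
    then show "card {c. c < N \<and> c \<notin> {a} \<and> w c \<in> {w a}} \<le> d - 1"
      using card_word_preimage[OF w', of "{w a}"] words_in[OF w'] assms by simp
  qed (use assms in auto)
  then show ?thesis by simp
qed

text \<open>The switching is run backwards: starting from any word, one of the \<open>d - 1\<close>
  other copies of the letter at \<open>a\<close> is moved to \<open>b\<close>. Every target is
  reached at most \<open>N\<close> times, and a failing swap requires a further coincidence, so the
  failures are of lower order.\<close>

lemma collision_lower:
  assumes a: "a < N" and b: "b < N" and ab: "a \<noteq> b" "{a, b} \<notin> G"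
  shows "real (card F) * (d - 1) \<le> card {w \<in> F. w b = w a} * real N + 6 * d * \<Delta> / card V * card F"
proof -
  define T where "T w = {c. c < N \<and> c \<noteq> a \<and> w c = w a}" for w :: "nat \<Rightarrow> 'a"
  define S where "S w = {c \<in> T w. swappable G w b c}" for w :: "nat \<Rightarrow> 'a"
  define I1 where "I1 = (SIGMA c:{c. c < N \<and> c \<noteq> a \<and> c \<noteq> b}. SIGMA c':{c'. {c, c'} \<in> G \<and> c' \<noteq> a \<and> c' \<noteq> b}.
     {w \<in> F. w c = w a \<and> w c' = w b})"
  define I2 where "I2 = (SIGMA c':{c'. {b, c'} \<in> G}. SIGMA w:{w \<in> F. w c' = w a}. {c. c < N \<and> w c \<in> {w a}})"
  \<comment> \<open>\<open>I1\<close> and \<open>I2\<close> cover the swaps that fail because of a conflict at \<open>c\<close> or at \<open>b\<close>, respectively.\<close>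
  have finT: "finite (T w)" for w by (simp add: T_def)
  have finS: "finite (S w)" for w using finT by (simp add: S_def)
  have cT: "card (T w) = d - 1" if "w \<in> F" for w
  proof -
    have w': "w \<in> words V d N" using that avoiding_subset_words by blast
    have "T w = {c. c < N \<and> w c \<in> {w a}} - {a}" by (auto simp: T_def)
    then show ?thesis
      using card_word_preimage[OF w', of "{w a}"] words_in[OF w'] a by simp
  qed
  have "(SIGMA w:F. T w) \<subseteq> (SIGMA w:F. S w) \<union> ((\<lambda>(c, c', w). (w, c)) ` I1 \<union> (\<lambda>(c', w, c). (w, c)) ` I2)"
  proof
    fix p assume "p \<in> (SIGMA w:F. T w)"
    then obtain w c where p: "p = (w, c)" "w \<in> F" "c < N" "c \<noteq> a" "w c = w a" by (auto simp: T_def)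
    have av: "w x \<noteq> w y" if "{x, y} \<in> G" for x y using p(2) that by (simp add: avoiding_def)
    show "p \<in> (SIGMA w:F. S w) \<union> ((\<lambda>(c, c', w). (w, c)) ` I1 \<union> (\<lambda>(c', w, c). (w, c)) ` I2)"
    proof (cases "swappable G w b c")
      case True
      then show ?thesis using p by (simp add: S_def T_def)
    next
      case False
      have second: ?thesis if "{b, x} \<in> G" "w x = w a" for x
      proof -
        have "(x, w, c) \<in> I2" using that p by (auto simp: I2_def)
        then show ?thesis using p by force
      qed
      from False consider x where "{c, x} \<in> G" "w x = w b" | x where "{b, x} \<in> G" "w x = w c"
        by (auto simp: swappable_def)
      then show ?thesis
      proof cases
        case 1
        have cb: "c \<noteq> b" using av 1 by metis
        have xa: "x \<noteq> a" using av 1 p by metis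
        show ?thesis
        \<comment> \<open>If the conflicting neighbour of \<open>c\<close> is \<open>b\<close>
          itself, then \<open>c\<close> is a neighbour of \<open>b\<close> with the letter of
          \<open>a\<close>, and the pair is charged to \<open>I2\<close>. This keeps the four
          positions in \<open>I1\<close> distinct.\<close>
        proof (cases "x = b")
          case True
          then show ?thesis using 1 p second[of c] by (simp add: insert_commute)
        next
          case False
          have "(c, x, w) \<in> I1" using False cb xa p 1 by (auto simp: I1_def)
          then show ?thesis using p by force
        qed
      next
        case 2
        then show ?thesis using second p by simp
      qed
    qed
  qed
  moreover have fI1: "finite I1"
    unfolding I1_def using fin_F nbrs(2) by (intro finite_SigmaI) (auto intro: finite_subset[OF _ nbrs(2)])
  moreover have fI2: "finite I2"
    unfolding I2_def using fin_F nbrs(2) by (intro finite_SigmaI) auto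
  ultimately have "card (SIGMA w:F. T w) \<le> card ((SIGMA w:F. S w) \<union> ((\<lambda>(c, c', w). (w, c)) ` I1 \<union> (\<lambda>(c', w, c). (w, c)) ` I2))"
    using fin_F finS by (intro card_mono) auto
  also have "\<dots> \<le> card (SIGMA w:F. S w) + (card I1 + card I2)"
    using card_Un_le[of "SIGMA w:F. S w" "(\<lambda>(c, c', w). (w, c)) ` I1 \<union> (\<lambda>(c', w, c). (w, c)) ` I2"]
      card_Un_le[of "(\<lambda>(c, c', w). (w, c)) ` I1" "(\<lambda>(c', w, c). (w, c)) ` I2"]
      card_image_le[OF fI1, of "\<lambda>(c, c', w). (w, c)"] card_image_le[OF fI2, of "\<lambda>(c', w, c). (w, c)"]
    by linarith
  finally have main: "card (SIGMA w:F. T w) \<le> card (SIGMA w:F. S w) + (card I1 + card I2)" .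
  have T: "card (SIGMA w:F. T w) = card F * (d - 1)"
    using fin_F finT cT by simp
  have S: "card (SIGMA w:F. S w) \<le> card {w \<in> F. w b = w a} * N"
  proof -
    have "card (SIGMA w:F. S w) \<le> card ({w \<in> F. w b = w a} \<times> {..<N})"
    proof (rule card_inj_on_le[where f = "\<lambda>(w, c). (w \<circ> Transposition.transpose b c, c)"])
      show "inj_on (\<lambda>(w, c). (w \<circ> Transposition.transpose b c, c)) (SIGMA w:F. S w)"
        by (rule inj_on_inverseI[where g = "\<lambda>(w, c). (w \<circ> Transposition.transpose b c, c)"])
          (auto simp: comp_assoc)
      show "(\<lambda>(w, c). (w \<circ> Transposition.transpose b c, c)) ` (SIGMA w:F. S w)
          \<subseteq> {w \<in> F. w b = w a} \<times> {..<N}"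
      proof safe
        fix w c assume w: "w \<in> F" "c \<in> S w"
        show "w \<circ> Transposition.transpose b c \<in> F"
          by (rule swap_avoiding[OF w(1) graph b]) (use w in \<open>auto simp: S_def T_def\<close>)
        show "(w \<circ> Transposition.transpose b c) b = (w \<circ> Transposition.transpose b c) a"
          using w ab by (auto simp: S_def T_def Transposition.transpose_def)
        show "c < N" using w by (simp add: S_def T_def)
      qed
      show "finite ({w \<in> F. w b = w a} \<times> {..<N})" using fin_F by simp
    qed
    then show ?thesis by (simp add: card_cartesian_product)
  qed
  \<comment> \<open>There are at most \<open>N * \<Delta>\<close> choices of \<open>c\<close> and
    \<open>c'\<close>, and \<open>pair_pair_prob\<close> applies to each.\<close>
  have I1: "real (card I1) \<le> 4 * d * \<Delta> / card V * card F"
  proof -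
    have fn: "finite {c'. {c, c'} \<in> G \<and> c' \<noteq> a \<and> c' \<noteq> b}" for c
      by (rule finite_subset[OF _ nbrs(2)[of c]]) auto
    have cn: "card {c'. {c, c'} \<in> G \<and> c' \<noteq> a \<and> c' \<noteq> b} \<le> \<Delta>" for c
      by (rule order.trans[OF card_mono nbrs(3)[of c]]) (use nbrs(2) in auto)
    have "real (card I1) = (\<Sum>c\<in>{c. c < N \<and> c \<noteq> a \<and> c \<noteq> b}. \<Sum>c'\<in>{c'. {c, c'} \<in> G \<and> c' \<noteq> a \<and> c' \<noteq> b}.
       real (card {w \<in> F. w c = w a \<and> w c' = w b}))"
      unfolding I1_def using fin_F fn by simp
    also have "\<dots> \<le> (\<Sum>c\<in>{c. c < N \<and> c \<noteq> a \<and> c \<noteq> b}. \<Sum>c'\<in>{c'. {c, c'} \<in> G \<and> c' \<noteq> a \<and> c' \<noteq> b}.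
       4 / (card V)\<^sup>2 * card F)"
    proof (intro sum_mono pair_pair_prob)
      fix c c' assume "c \<in> {c. c < N \<and> c \<noteq> a \<and> c \<noteq> b}" "c' \<in> {c'. {c, c'} \<in> G \<and> c' \<noteq> a \<and> c' \<noteq> b}"
      then show "distinct [a, b, c, c']" "c < N" "c' < N" using edge_neq[of c c'] ab nbrs(1)[of c] by auto
    qed (use a b in auto)
    also have "\<dots> \<le> (\<Sum>c\<in>{c. c < N \<and> c \<noteq> a \<and> c \<noteq> b}. \<Delta> * (4 / (card V)\<^sup>2 * card F))"
    proof (intro sum_mono)
      fix c 
      show "(\<Sum>c'\<in>{c'. {c, c'} \<in> G \<and> c' \<noteq> a \<and> c' \<noteq> b}. 4 / real ((card V)\<^sup>2) * real (card F))
         \<le> \<Delta> * (4 / real ((card V)\<^sup>2) * real (card F))"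
        using cn[of c] by (simp add: mult_right_mono divide_right_mono)
    qed
    also have "\<dots> = card {c. c < N \<and> c \<noteq> a \<and> c \<noteq> b} * (\<Delta> * (4 / (card V)\<^sup>2 * card F))" by simp
    also have "\<dots> \<le> N * (\<Delta> * (4 / (card V)\<^sup>2 * card F))"
    proof (intro mult_right_mono)
      have "card {c. c < N \<and> c \<noteq> a \<and> c \<noteq> b} \<le> card {..<N}" by (rule card_mono) auto
      then show "real (card {c. c < N \<and> c \<noteq> a \<and> c \<noteq> b}) \<le> real N" by simp
    qed auto
    also have "\<dots> = 4 * d * \<Delta> / card V * card F"
      using card_V_pos by (simp add: N_eq power2_eq_square field_simps)
    finally show ?thesis .
  qed
  \<comment> \<open>There are at most \<Delta> neighbours \<open>c'\<close> of \<open>b\<close>,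
    each agreeing with \<open>a\<close> with probability at most \<open>2 / card V\<close>, and then
    \<open>d\<close> choices of \<open>c\<close>.\<close>
  have I2: "real (card I2) \<le> 2 * d * \<Delta> / card V * card F"
  proof -
    have "real (card I2) = (\<Sum>c'\<in>{c'. {b, c'} \<in> G}. real (card (SIGMA w:{w \<in> F. w c' = w a}. {c. c < N \<and> w c \<in> {w a}})))"
      unfolding I2_def using nbrs(2) fin_F by (subst card_SigmaI) auto
    also have "\<dots> \<le> (\<Sum>c'\<in>{c'. {b, c'} \<in> G}. 2 / card V * card F * d)"
    proof (rule sum_mono)
      fix c' assume c': "c' \<in> {c'. {b, c'} \<in> G}"
      have "card (SIGMA w:{w \<in> F. w c' = w a}. {c. c < N \<and> w c \<in> {w a}}) = card {w \<in> F. w c' = w a} * d"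
      proof -
        have "card {c. c < N \<and> w c \<in> {w a}} = d" if "w \<in> F" for w
        proof -
          have w': "w \<in> words V d N" using that avoiding_subset_words by blast
          show ?thesis using card_word_preimage[OF w', of "{w a}"] words_in[OF w' a] by simp
        qed
        then show ?thesis using fin_F by simp
      qed
      moreover have "real (card {w \<in> F. w c' = w a}) \<le> 2 / card V * card F"
      proof (rule pair_prob)
        \<comment> \<open>Here it matters that \<open>a\<close> and \<open>b\<close> are not
          adjacent.\<close>
        show "a \<noteq> c'" using c' ab by (auto simp: insert_commute)
      qed (use a c' nbrs(1)[of b] in auto)
      ultimately show "real (card (SIGMA w:{w \<in> F. w c' = w a}. {c. c < N \<and> w c \<in> {w a}})) \<le> 2 / card V * card F * d"
        using mult_right_mono[of "real (card {w \<in> F. w c' = w a})" "2 / card V * card F" "real d"]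
        by (simp del: card_SigmaI)
    qed
    also have "\<dots> = card {c'. {b, c'} \<in> G} * (2 / card V * card F * d)" by simp
    also have "\<dots> \<le> \<Delta> * (2 / card V * card F * d)"
      using nbrs(3)[of b] by (intro mult_right_mono) auto
    finally show ?thesis by (simp add: mult_ac)
  qed
  have "real (card F) * (d - 1) = real (card F * (d - 1))" by simp
  also have "\<dots> \<le> real (card {w \<in> F. w b = w a} * N) + (card I1 + card I2)"
    using main S unfolding T by linarith
  also have "\<dots> = card {w \<in> F. w b = w a} * real N + (real (card I1) + real (card I2))"
    by simp
  also have "\<dots> \<le> card {w \<in> F. w b = w a} * real N +
      (4 * d * \<Delta> / card V * card F + 2 * d * \<Delta> / card V * card F)"
    by (intro add_left_mono add_mono[OF I1 I2])
  also have "4 * d * \<Delta> / card V * card F + 2 * d * \<Delta> / card V * card F = 6 * d * \<Delta> / card V * real (card F)"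
    using card_V_pos by (simp add: field_simps)
  finally show ?thesis .
qed

text \<open>The two switchings place \<open>x * N\<close> within
  \<open>6 * d * \<Delta> / card V\<close> of \<open>d - 1\<close>; dividing by
  \<open>N = d * card V\<close> removes the factor \<open>d\<close> from the error.\<close>

lemma collision_estimate:
  assumes a: "a < N" "b < N" "a \<noteq> b" "{a, b} \<notin> G" and ne: "F \<noteq> {}"
  defines "x \<equiv> real (card {w \<in> F. w b = w a}) / card F"
  shows "\<bar>x - (d - 1) / N\<bar> \<le> 6 * \<Delta> / (card V)\<^sup>2" and "x \<le> 2 / card V"
proof -
  let ?n = "real (card V)"
  have Fp: "real (card F) > 0" using ne fin_F by (simp add: card_gt_0_iff)
  have n: "?n > 0" "real d > 0" "real \<Delta> \<ge> 2" using card_V_pos d_pos \<Delta>_ge by auto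
  show x2: "x \<le> 2 / card V"
    using pair_prob[of a b] a Fp by (simp add: x_def field_simps)
  have x0: "x \<ge> 0" by (simp add: x_def)
  have X: "real (card {w \<in> F. w b = w a}) = x * card F" using Fp by (simp add: x_def)
  have "real (card {w \<in> F. w b = w a} * (N - 2 * d * \<Delta> - 1)) \<le> real (card F * (d - 1))"
    using collision_upper a by (intro of_nat_mono) auto
  then have "x * card F * real (N - 2 * d * \<Delta> - 1) \<le> real (card F) * real (d - 1)" by (simp add: X)
  then have "real (card F) * (x * real (N - 2 * d * \<Delta> - 1)) \<le> real (card F) * real (d - 1)"
    by (simp add: mult_ac)
  then have up: "x * real (N - 2 * d * \<Delta> - 1) \<le> real (d - 1)" using Fp by simp
  have "real (N - 2 * d * \<Delta> - 1) = real N - 2 * d * \<Delta> - 1"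
  proof -
    have "2 * (d * \<Delta>) + 1 \<le> N" using N_large \<Delta>_le \<Delta>_ge by linarith
    then have "real (N - (2 * (d * \<Delta>) + 1)) = real N - real (2 * (d * \<Delta>) + 1)" by (rule of_nat_diff)
    then show ?thesis by (simp add: mult.assoc)
  qed
  moreover have "real \<Delta> \<le> d * \<Delta>" using \<Delta>_le by (simp flip: of_nat_mult)
  ultimately have "x * (real N - 3 * d * \<Delta>) \<le> real (d - 1)"
  proof -
    assume e: "real (N - 2 * d * \<Delta> - 1) = real N - 2 * d * \<Delta> - 1" and "real \<Delta> \<le> d * \<Delta>"
    then have "1 \<le> real (d * \<Delta>)" using n by linarith
    then have "real N - 3 * d * \<Delta> \<le> real (N - 2 * d * \<Delta> - 1)" unfolding e by (simp add: mult.commute)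
    then have "x * (real N - 3 * d * \<Delta>) \<le> x * real (N - 2 * d * \<Delta> - 1)" using x0 mult_left_mono by blast
    then show ?thesis using up by linarith
  qed
  then have "x * N \<le> (d - 1) + x * (3 * d * \<Delta>)" by (simp add: algebra_simps)
  \<comment> \<open>In the correction term the crude bound on \<open>x\<close> suffices; it gives
    the same error as the lower bound.\<close>
  also have "\<dots> \<le> real (d - 1) + 2 / ?n * (3 * d * \<Delta>)" using mult_right_mono[OF x2, of "3 * d * \<Delta>"] by simp
  finally have 1: "x * N \<le> real (d - 1) + 6 * d * \<Delta> / ?n" by simp
  have "real (card F) * (d - 1) \<le> x * card F * N + 6 * d * \<Delta> / ?n * card F"
    using collision_lower[OF a] by (simp add: X)
  then have "real (card F) * (d - 1) \<le> real (card F) * (x * N + 6 * d * \<Delta> / ?n)"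
    by (simp add: algebra_simps)
  then have 2: "real (d - 1) \<le> x * N + 6 * d * \<Delta> / ?n" using Fp by simp
  have "\<bar>x * N - (d - 1)\<bar> \<le> 6 * d * \<Delta> / ?n" using 1 2 d_pos by (simp add: abs_le_iff)
  moreover have "x - (d - 1) / N = (x * N - (d - 1)) / N" using N_pos by (simp add: field_simps)
  moreover have "6 * d * \<Delta> / ?n / N = 6 * \<Delta> / (card V)\<^sup>2"
    using n by (simp add: N_eq power2_eq_square field_simps)
  ultimately show "\<bar>x - (d - 1) / N\<bar> \<le> 6 * \<Delta> / (card V)\<^sup>2"
    by (metis abs_divide abs_of_nat divide_right_mono of_nat_0_le_iff)
qed

end

text \<open>Induction over the conflict edges is the chain rule: a new edge multiplies the count by
  \<open>1 - x\<close>, where \<open>x\<close> is its conditional collision probability, and the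
  logarithms add up. Nonemptiness is carried along so that the next conditional probability makes
  sense.\<close>

theorem avoiding_estimate:
  assumes V: "finite V" and N: "N = d * card V" and d: "1 \<le> d" and \<Delta>: "2 \<le> \<Delta>" and n: "100 * \<Delta> \<le> card V"
    and G: "conflict_graph N \<Delta> G"
  shows "avoiding V d N G \<noteq> {} \<and>
    \<bar>ln (card (avoiding V d N G) / card (words V d N)) + card G * ((real d - 1) / N)\<bar>
      \<le> card G * (10 * \<Delta> / (card V)\<^sup>2)"
proof -
  have "finite G"
    by (rule finite_subset[of _ "Pow {..<N}"]) (use G in \<open>auto simp: conflict_graph_def\<close>)
  then show ?thesis using G
  proof (induction G rule: finite_induct)
    case empty
    have "card (words V d N) * fact d ^ card V \<noteq> 0"
      unfolding card_words[OF V N] by simp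
    then have "card (words V d N) \<noteq> 0" by simp
    then show ?case by (auto simp: avoiding_def)
  next
    case (insert e G)
    have G: "conflict_graph N \<Delta> G"
      unfolding conflict_graph_def
    proof (intro conjI allI)
      show "\<forall>e\<in>G. e \<subseteq> {..<N} \<and> card e = 2" using insert.prems by (auto simp: conflict_graph_def)
      fix b
      have fin: "finite {c. {b, c} \<in> insert e G}"
        by (rule finite_subset[of _ "{..<N}"]) (use insert.prems in \<open>auto simp: conflict_graph_def\<close>)
      have "card {c. {b, c} \<in> G} \<le> card {c. {b, c} \<in> insert e G}"
        by (rule card_mono[OF fin]) auto
      then show "card {c. {b, c} \<in> G} \<le> \<Delta>"
        using insert.prems by (auto simp: conflict_graph_def intro: order.trans)
    qed
    interpret conflict_model V d N \<Delta> G
      by unfold_locales (use V N d \<Delta> n G in auto)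
    note IH = insert.IH[OF G]
    obtain a b where e: "e = {a, b}" "a \<noteq> b" "a < N" "b < N"
    proof -
      have "card e = 2" "e \<subseteq> {..<N}" using insert.prems by (auto simp: conflict_graph_def)
      then show ?thesis using that by (auto simp: card_2_iff)
    qed
    define x where "x = real (card {w \<in> F. w b = w a}) / card F"
    have est: "\<bar>x - (d - 1) / N\<bar> \<le> 6 * \<Delta> / (card V)\<^sup>2" "x \<le> 2 / card V"
      unfolding x_def by (rule collision_estimate; use e insert.hyps IH in auto)+
    have Fp: "real (card F) > 0" using IH fin_F by (simp add: card_gt_0_iff)
    have x0: "0 \<le> x" by (simp add: x_def)
    have "2 / card V \<le> 1 / 2" using large \<Delta>_ge by (simp add: field_simps)
    then have x1: "x \<le> 1 / 2" using est(2) by linarith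
    have eq: "avoiding V d N (insert e G) = F - {w \<in> F. w b = w a}"
      using e by (auto simp: avoiding_def doubleton_eq_iff)
    have "card (avoiding V d N (insert e G)) = card F - card {w \<in> F. w b = w a}"
      unfolding eq by (rule card_Diff_subset) (use fin_F in auto)
    moreover have "card {w \<in> F. w b = w a} \<le> card F" by (rule card_mono) (use fin_F in auto)
    ultimately have cd: "real (card (avoiding V d N (insert e G))) = card F * (1 - x)"
      using Fp by (simp add: x_def of_nat_diff field_simps)
    have pos: "real (card (avoiding V d N (insert e G))) > 0"
      unfolding cd using Fp x1 by simp
    have wp: "real (card (words V d N)) > 0"
      using IH card_gt_0_iff avoiding_subset_words finite_words[OF V] by fastforce
    have "ln (card (avoiding V d N (insert e G)) / card (words V d N))
      = ln (card F / card (words V d N)) + ln (1 - x)"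
      unfolding cd using Fp wp x1 by (simp add: ln_mult ln_div)
    moreover have "\<bar>ln (1 - x) + (d - 1) / N\<bar> \<le> 10 * \<Delta> / (card V)\<^sup>2"
    proof -
      \<comment> \<open>The quadratic error is at most \<open>8 / (card V)^2\<close>. As \<Delta> is
        at least 2, \<open>8 + 6 * \<Delta>\<close> fits into \<open>10 * \<Delta>\<close>.\<close>
      have "\<bar>ln (1 + - x) - (- x)\<bar> \<le> 2 * (- x)\<^sup>2"
        by (rule abs_ln_one_plus_x_minus_x_bound_nonpos) (use x0 x1 in auto)
      also have "\<dots> \<le> 2 * (2 / card V)\<^sup>2" using est(2) x0 by (simp add: power_mono del: power_divide)
      also have "\<dots> = 8 / (card V)\<^sup>2" by (simp add: power2_eq_square)
      finally have "\<bar>ln (1 - x) + x\<bar> \<le> 8 / (card V)\<^sup>2" by simp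
      then have "\<bar>ln (1 - x) + (d - 1) / N\<bar> \<le> 8 / (card V)\<^sup>2 + 6 * \<Delta> / (card V)\<^sup>2"
        using est(1) by linarith
      also have "\<dots> = (8 + 6 * \<Delta>) / (card V)\<^sup>2" by (simp add: add_divide_distrib)
      also have "\<dots> \<le> 10 * \<Delta> / (card V)\<^sup>2" using \<Delta>_ge by (intro divide_right_mono) auto
      finally show ?thesis .
    qed
    moreover have "real (d - 1) = real d - 1" using d by (simp add: of_nat_diff)
    \<comment> \<open>Logarithms, slope and error are abstracted to real variables, which leaves an
      elementary induction step.\<close>
    ultimately have step: "L' = L + ln (1 - x)" "\<bar>ln (1 - x) + u\<bar> \<le> v"
      if "L' = ln (card (avoiding V d N (insert e G)) / card (words V d N))"
        "L = ln (card F / card (words V d N))" "u = (real d - 1) / N" "v = 10 * \<Delta> / (card V)\<^sup>2" for L L' u v :: real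
      using that by auto
    have "\<bar>L' + card (insert e G) * u\<bar> \<le> card (insert e G) * v"
      if "L' = ln (card (avoiding V d N (insert e G)) / card (words V d N))"
        "u = (real d - 1) / N" "v = 10 * \<Delta> / (card V)\<^sup>2" for L' u v :: real
    proof -
      define L where "L = ln (card F / card (words V d N))"
      have "\<bar>L + card G * u\<bar> \<le> card G * v" using IH by (simp add: L_def that)
      then show ?thesis
        using step[OF that(1) L_def that(2,3)] insert.hyps by (simp add: distrib_right)
    qed
    then show ?case using pos by auto
  qed
qed

section \<open>Words divided into blocks\<close>

definition block :: "nat \<Rightarrow> nat \<Rightarrow> nat set" where
  "block r i = {i * r..<i * r + r}"

text \<open>A disjoint union of \<open>m\<close> cliques on \<open>r\<close> positions each;
  avoiding it means that no letter repeats within a block.\<close>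

definition row_graph :: "nat \<Rightarrow> nat \<Rightarrow> nat set set" where
  "row_graph r m = (\<Union>i<m. {e. e \<subseteq> block r i \<and> card e = 2})"

lemma in_block_iff: "0 < r \<Longrightarrow> c \<in> block r i \<longleftrightarrow> c div r = i"
proof
  assume r: "0 < r"
  show "c div r = i" if "c \<in> block r i"
    using that by (intro div_nat_eqI) (auto simp: block_def mult.commute)
  show "c \<in> block r i" if "c div r = i"
    using that r dividend_less_div_times[of r c] by (auto simp: block_def add.commute)
qed

lemma finite_block [simp]: "finite (block r i)" and card_block [simp]: "card (block r i) = r"
  by (auto simp: block_def)

lemma block_disjoint: "i \<noteq> j \<Longrightarrow> block r i \<inter> block r j = {}"
proof (cases "r = 0")
  case False
  assume "i \<noteq> j"
  then show ?thesis using in_block_iff[of r] False by auto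
qed (simp add: block_def)

lemma block_subset:
  assumes "i < m" shows "block r i \<subseteq> {..<m * r}"
proof -
  have "(i + 1) * r \<le> m * r" using assms by (intro mult_right_mono) auto
  then show ?thesis by (auto simp: block_def)
qed

lemma conflict_graph_row_graph: "conflict_graph (m * r) r (row_graph r m)"
  unfolding conflict_graph_def
proof (intro conjI allI ballI)
  fix e assume "e \<in> row_graph r m"
  then obtain i where "i < m" "e \<subseteq> block r i" "card e = 2" by (auto simp: row_graph_def)
  then show "e \<subseteq> {..<m * r}" "card e = 2" using block_subset[of i m r] by auto
next
  fix b
  have "{c. {b, c} \<in> row_graph r m} \<subseteq> block r (b div r)"
  proof (cases "r = 0")
    case True
    then show ?thesis by (auto simp: row_graph_def block_def)
  next
    case False
    then show ?thesis by (auto simp: row_graph_def in_block_iff)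
  qed
  then have "card {c. {b, c} \<in> row_graph r m} \<le> card (block r (b div r))" by (intro card_mono) auto
  then show "card {c. {b, c} \<in> row_graph r m} \<le> r" by simp
qed

lemma card_row_graph: "card (row_graph r m) = m * (r choose 2)"
proof -
  have "card (row_graph r m) = (\<Sum>i<m. card {e. e \<subseteq> block r i \<and> card e = 2})"
    unfolding row_graph_def
  proof (rule card_UN_disjoint)
    show "\<forall>i\<in>{..<m}. finite {e. e \<subseteq> block r i \<and> card e = 2}"
      by (auto intro: finite_subset[of _ "Pow (block r _)"])
    show "\<forall>i\<in>{..<m}. \<forall>j\<in>{..<m}. i \<noteq> j \<longrightarrow>
       {e. e \<subseteq> block r i \<and> card e = 2} \<inter> {e. e \<subseteq> block r j \<and> card e = 2} = {}"
    proof (intro ballI impI equals0I)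
      fix i j :: nat and e
      assume "i \<noteq> j" and e: "e \<in> {e. e \<subseteq> block r i \<and> card e = 2} \<inter> {e. e \<subseteq> block r j \<and> card e = 2}"
      then have "e \<subseteq> {}" using block_disjoint[of i j r] by blast
      then show False using e by simp
    qed
  qed simp
  also have "\<dots> = m * (r choose 2)" by (simp add: n_subsets)
  finally show ?thesis .
qed

definition loopfree :: "'a set \<Rightarrow> nat \<Rightarrow> nat \<Rightarrow> nat \<Rightarrow> (nat \<Rightarrow> 'a) set" where
  "loopfree V d r m = {w \<in> words V d (m * r). \<forall>i<m. inj_on w (block r i)}"

lemma loopfree_eq_avoiding: "loopfree V d r m = avoiding V d (m * r) (row_graph r m)"
proof -
  have "(\<forall>i<m. inj_on w (block r i)) \<longleftrightarrow> (\<forall>a b. {a, b} \<in> row_graph r m \<longrightarrow> w a \<noteq> w b)" for w :: "nat \<Rightarrow> 'a"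
  proof safe
    fix a b assume w: "\<forall>i<m. inj_on w (block r i)" "{a, b} \<in> row_graph r m" "w a = w b"
    then obtain i where "i < m" "a \<in> block r i" "b \<in> block r i" "card {a, b} = 2" by (auto simp: row_graph_def)
    then show False using w by (auto simp: inj_on_def card_insert_if split: if_splits)
  next
    fix i assume w: "\<forall>a b. {a, b} \<in> row_graph r m \<longrightarrow> w a \<noteq> w b" and i: "i < m"
    show "inj_on w (block r i)"
    proof (rule inj_onI, rule ccontr)
      fix a b assume "a \<in> block r i" "b \<in> block r i" "w a = w b" "a \<noteq> b"
      moreover from this have "{a, b} \<in> row_graph r m" using i by (auto simp: row_graph_def)
      ultimately show False using w by blast
    qed
  qed
  then show ?thesis by (auto simp: loopfree_def avoiding_def)
qed

text \<open>There are \<open>m * (r choose 2)\<close> conflict edges, each contributing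
  \<open>(d - 1) / (m * r)\<close>, which sums to the stated main term. By
  \<open>m * r = d * card V\<close> the errors sum to
  \<open>5 * d * (r - 1) * r / card V\<close>.\<close>

lemma loopfree_estimate:
  assumes V: "finite V" and N: "m * r = d * card V" and d: "1 \<le> d" and r: "2 \<le> r" and n: "100 * r \<le> card V"
  shows "loopfree V d r m \<noteq> {}"
    and "\<bar>ln (card (loopfree V d r m) / card (words V d (m * r))) + (real r - 1) * (real d - 1) / 2\<bar>
           \<le> 5 * real d * (real r)\<^sup>2 / card V"
proof -
  let ?g = "card (row_graph r m)"
  have est: "loopfree V d r m \<noteq> {} \<and>
    \<bar>ln (card (loopfree V d r m) / card (words V d (m * r))) + ?g * ((real d - 1) / (m * r))\<bar>
      \<le> ?g * (10 * r / (card V)\<^sup>2)"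
    unfolding loopfree_eq_avoiding
    using avoiding_estimate[OF V N d r n conflict_graph_row_graph] by simp
  then show "loopfree V d r m \<noteq> {}" by blast
  have np: "real (card V) > 0" "real r > 0" "real d > 0" "real m > 0"
    using n r d N by (auto intro!: Nat.gr0I)
  have "even (r * (r - 1))" by (cases r) auto
  then have c2: "2 * (r choose 2) = r * (r - 1)" by (simp add: choose_two)
  have "2 * real (r choose 2) = real r * (real r - 1)"
    using arg_cong[of _ _ real, OF c2] r by (simp add: of_nat_diff)
  then have g: "real ?g = real m * (real r * (real r - 1) / 2)"
    by (simp add: card_row_graph)
  have N': "real m * real r = real d * real (card V)"
    using N by (metis of_nat_mult)
  have "?g * ((real d - 1) / (m * r)) = (real r - 1) * (real d - 1) / 2"
    using np d by (simp add: g of_nat_diff field_simps)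
  moreover have "?g * (10 * r / (card V)\<^sup>2) \<le> 5 * real d * (real r)\<^sup>2 / card V"
  proof -
    have "?g * (10 * r / (card V)\<^sup>2) = (real m * real r) * (real r - 1) * 5 * r / (card V)\<^sup>2"
      by (simp add: g)
    also have "\<dots> = 5 * d * (real r - 1) * r / card V"
      unfolding N' using np by (simp add: power2_eq_square)
    also have "\<dots> \<le> 5 * real d * (real r)\<^sup>2 / card V"
      unfolding power2_eq_square using np by (intro divide_right_mono) (auto simp: algebra_simps)
    finally show ?thesis .
  qed
  ultimately show "\<bar>ln (card (loopfree V d r m) / card (words V d (m * r))) + (real r - 1) * (real d - 1) / 2\<bar>
           \<le> 5 * real d * (real r)\<^sup>2 / card V"
    using est by linarith
qed

section \<open>Repeated edges and edges of a given matching\<close>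

context conflict_model
begin

text \<open>The three positions are switched in turn, each joining the protected set for the next.
  Three factors of order \<open>r / n\<close> outweigh the order \<open>(d * n / r)^2\<close> of
  pairs of blocks in the union bound.\<close>

lemma three_in_row_prob:
  assumes I: "I \<subseteq> {..<N}" "card I \<le> \<Delta>" and b: "b0 < N" "b1 < N" "b2 < N" "distinct [b0, b1, b2]"
    and bI: "b0 \<notin> I" "b1 \<notin> I" "b2 \<notin> I"
  shows "real (card {w \<in> F. (w b0 \<in> w ` I \<and> w b1 \<in> w ` I) \<and> w b2 \<in> w ` I}) \<le> (2 * real \<Delta> / card V) ^ 3 * card F"
proof -
  let ?p = "2 * real \<Delta> / card V"
  have finI: "finite I" using I finite_subset by blast
  have R: "w ` I \<subseteq> V \<and> card (w ` I) \<le> \<Delta>" if "w \<in> F" for w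
    using that I card_image_le[OF finI, of w] words_in avoiding_subset_words by fastforce
  have agree: "w ` I = w' ` I" if "\<And>x. x \<in> I \<Longrightarrow> w x = w' x" for w w' :: "nat \<Rightarrow> 'a"
    by (rule image_cong) (use that in auto)
  have "real (card {w \<in> F. True \<and> w b0 \<in> w ` I}) \<le> ?p * card {w \<in> F. True}"
  proof (rule switch_prob[where Q = I])
    show "True = True \<and> w ` I = w' ` I" if "\<And>x. x \<in> I \<Longrightarrow> w x = w' x" for w w' :: "nat \<Rightarrow> 'a"
      using agree[OF that] by simp
  qed (use R I b bI finI in auto)
  then have 1: "real (card {w \<in> F. w b0 \<in> w ` I}) \<le> ?p * card F" by simp
  have 2: "real (card {w \<in> F. w b0 \<in> w ` I \<and> w b1 \<in> w ` I}) \<le> ?p * card {w \<in> F. w b0 \<in> w ` I}"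
  proof (rule switch_prob[where Q = "insert b0 I"])
    show "(w b0 \<in> w ` I) = (w' b0 \<in> w' ` I) \<and> w ` I = w' ` I"
      if "\<And>x. x \<in> insert b0 I \<Longrightarrow> w x = w' x" for w w' :: "nat \<Rightarrow> 'a"
      using agree[of w w'] that by simp
  qed (use R I b bI finI in \<open>auto simp: card_insert_if\<close>)
  have 3: "real (card {w \<in> F. (w b0 \<in> w ` I \<and> w b1 \<in> w ` I) \<and> w b2 \<in> w ` I})
     \<le> ?p * card {w \<in> F. w b0 \<in> w ` I \<and> w b1 \<in> w ` I}"
  proof (rule switch_prob[where Q = "insert b1 (insert b0 I)"])
    show "(w b0 \<in> w ` I \<and> w b1 \<in> w ` I) = (w' b0 \<in> w' ` I \<and> w' b1 \<in> w' ` I) \<and> w ` I = w' ` I"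
      if "\<And>x. x \<in> insert b1 (insert b0 I) \<Longrightarrow> w x = w' x" for w w' :: "nat \<Rightarrow> 'a"
      using agree[of w w'] that by simp
  qed (use R I b bI finI in \<open>auto simp: card_insert_if\<close>)
  have "?p * (?p * (?p * card F)) \<ge> ?p * (?p * card {w \<in> F. w b0 \<in> w ` I})"
    using 1 by (intro mult_left_mono) auto
  moreover have "?p * (?p * card {w \<in> F. w b0 \<in> w ` I}) \<ge> ?p * card {w \<in> F. w b0 \<in> w ` I \<and> w b1 \<in> w ` I}"
    using 2 by (intro mult_left_mono) auto
  moreover have "?p * (?p * (?p * card F)) = ?p ^ 3 * card F" by (simp add: power3_eq_cube)
  ultimately show ?thesis using 3 by linarith
qed

text \<open>Meant for \<open>p v\<close> the matching edge through \<open>v\<close>: the letter at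
  \<open>b0\<close> selects the edge freely, and only \<open>b1\<close> and \<open>b2\<close> are
  constrained. Two factors are enough for a union bound over single blocks.\<close>

lemma two_in_part_prob:
  assumes p: "\<And>v. v \<in> V \<Longrightarrow> p v \<subseteq> V \<and> card (p v) \<le> \<Delta>"
    and b: "b0 < N" "b1 < N" "b2 < N" "distinct [b0, b1, b2]"
  shows "real (card {w \<in> F. w b1 \<in> p (w b0) \<and> w b2 \<in> p (w b0)}) \<le> (2 * real \<Delta> / card V)\<^sup>2 * card F"
proof -
  let ?p = "2 * real \<Delta> / card V"
  have R: "p (w b0) \<subseteq> V \<and> card (p (w b0)) \<le> \<Delta>" if "w \<in> F" for w
    using p words_in[OF _ b(1)] that avoiding_subset_words by blast
  have "real (card {w \<in> F. True \<and> w b1 \<in> p (w b0)}) \<le> ?p * card {w \<in> F. True}"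
    by (rule switch_prob[where Q = "{b0}"]) (use R b in auto)
  then have 1: "real (card {w \<in> F. w b1 \<in> p (w b0)}) \<le> ?p * card F" by simp
  have 2: "real (card {w \<in> F. w b1 \<in> p (w b0) \<and> w b2 \<in> p (w b0)}) \<le> ?p * card {w \<in> F. w b1 \<in> p (w b0)}"
    by (rule switch_prob[where Q = "{b0, b1}"]) (use R b in auto)
  have "?p * (?p * card F) \<ge> ?p * card {w \<in> F. w b1 \<in> p (w b0)}"
    using 1 by (intro mult_left_mono) auto
  moreover have "?p * (?p * card F) = ?p\<^sup>2 * card F" by (simp add: power2_eq_square)
  ultimately show ?thesis using 2 by linarith
qed

end

text \<open>Distinctness is asked of the letter sets of the blocks, since the order of vertices
  inside an edge does not matter.\<close>

definition simple_words :: "'a set \<Rightarrow> nat \<Rightarrow> nat \<Rightarrow> nat \<Rightarrow> (nat \<Rightarrow> 'a) set" where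
  "simple_words V d r m = {w \<in> loopfree V d r m. inj_on (\<lambda>i. w ` block r i) {..<m}}"

lemma finite_loopfree: "finite V \<Longrightarrow> finite (loopfree V d r m)"
  by (simp add: loopfree_def finite_words)

lemma real_card_UN_bound:
  fixes x :: real
  assumes "finite I" "\<And>i. i \<in> I \<Longrightarrow> real (card (A i)) \<le> x"
  shows "real (card (\<Union>i\<in>I. A i)) \<le> card I * x"
proof -
  have "real (card (\<Union>i\<in>I. A i)) \<le> real (\<Sum>i\<in>I. card (A i))"
    using card_UN_le[OF assms(1)] by (intro of_nat_mono)
  also have "\<dots> \<le> (\<Sum>i\<in>I. x)" using assms(2) by (simp add: sum_bounded_above)
  finally show ?thesis by simp
qed

lemma block_three:
  assumes "3 \<le> r"
  shows "i * r \<in> block r i" "i * r + 1 \<in> block r i" "i * r + 2 \<in> block r i"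
  using assms by (auto simp: block_def)

text \<open>Union bound over pairs of blocks: \<open>m^2 * (2 * r / n)^3\<close> with
  \<open>m * r = d * n\<close> and \<open>n = card V\<close> equals
  \<open>8 * d^2 * r / n\<close>.\<close>

lemma repeated_rows_bound:
  assumes V: "finite V" and N: "m * r = d * card V" and d: "1 \<le> d" and r: "3 \<le> r" and n: "100 * r \<le> card V"
  shows "real (card (loopfree V d r m - simple_words V d r m)) \<le> 8 * (real d)\<^sup>2 * real r / card V * card (loopfree V d r m)"
proof -
  interpret conflict_model V d "m * r" r "row_graph r m"
    by unfold_locales (use assms conflict_graph_row_graph[of m r] in auto)
  have F: "loopfree V d r m = F" by (rule loopfree_eq_avoiding)
  let ?A = "\<lambda>(i, j). {w \<in> F. w ` block r i = w ` block r j}"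
  let ?I = "{(i, j). i < m \<and> j < m \<and> i \<noteq> j}"
  have fI: "finite ?I" by (rule finite_subset[of _ "{..<m} \<times> {..<m}"]) auto
  have cI: "card ?I \<le> m * m"
    using card_mono[of "{..<m} \<times> {..<m}" ?I] by (force simp: card_cartesian_product)
  have np: "real (card V) > 0" "real r > 0" "real d > 0" using n r d by auto
  have N': "real m * real r = real d * real (card V)" using N by (metis of_nat_mult)
  have "loopfree V d r m - simple_words V d r m \<subseteq> (\<Union>i\<in>?I. ?A i)"
    by (auto simp: simple_words_def F inj_on_def)
  then have "card (loopfree V d r m - simple_words V d r m) \<le> card (\<Union>i\<in>?I. ?A i)"
    by (rule card_mono[rotated]) (use fI fin_F in auto)
  also have "real (card (\<Union>i\<in>?I. ?A i)) \<le> card ?I * ((2 * real r / card V) ^ 3 * card F)"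
  proof (rule real_card_UN_bound[OF fI])
    fix p assume "p \<in> ?I"
    then obtain i j where p: "p = (i, j)" "i < m" "j < m" "i \<noteq> j" by auto
    have dis: "x \<notin> block r i" if "x \<in> block r j" for x using block_disjoint[OF p(4)] that by blast
    have lt: "x < m * r" if "x \<in> block r j" for x using block_subset[OF p(3)] that by blast
    \<comment> \<open>Equality of the blocks is weakened to a condition on the first three letters
      of block \<open>j\<close>, which exist because \<open>r\<close> is at least 3.\<close>
    have "?A p \<subseteq> {w \<in> F. (w (j * r) \<in> w ` block r i \<and> w (j * r + 1) \<in> w ` block r i) \<and> w (j * r + 2) \<in> w ` block r i}"
      using block_three[OF r, of j] by (auto simp: p(1))
    then have "card (?A p) \<le> card {w \<in> F. (w (j * r) \<in> w ` block r i \<and> w (j * r + 1) \<in> w ` block r i) \<and> w (j * r + 2) \<in> w ` block r i}"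
      by (rule card_mono[rotated]) (use fin_F in auto)
    also have "real \<dots> \<le> (2 * real r / card V) ^ 3 * card F"
      by (rule three_in_row_prob) (use block_subset[OF p(2)] block_three[OF r, of j] dis lt p r in auto)
    finally show "real (card (?A p)) \<le> (2 * real r / card V) ^ 3 * card F" by simp
  qed
  also have "\<dots> \<le> real (m * m) * ((2 * real r / card V) ^ 3 * card F)"
    using cI by (intro mult_right_mono of_nat_mono) auto
  also have "\<dots> = (real m * r) * (real m * r) * 8 * r / card V ^ 3 * card F"
    by (simp add: power3_eq_cube)
  also have "\<dots> = 8 * (real d)\<^sup>2 * real r / card V * card F"
    unfolding N' using np by (simp add: power3_eq_cube power2_eq_square)
  finally show ?thesis by (simp add: F)
qed

text \<open>The assumptions make \<open>M\<close> a partition of \<open>V\<close> into sets of size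
  \<open>r\<close>. The union bound over blocks gives
  \<open>m * (2 * r / n)^2 = 4 * d * r / n\<close> with \<open>n = card V\<close>.\<close>

lemma matching_rows_bound:
  assumes V: "finite V" and N: "m * r = d * card V" and d: "1 \<le> d" and r: "3 \<le> r" and n: "100 * r \<le> card V"
    and M: "\<And>e. e \<in> M \<Longrightarrow> e \<subseteq> V \<and> card e = r" "\<And>v. v \<in> V \<Longrightarrow> \<exists>!e. e \<in> M \<and> v \<in> e"
  shows "real (card {w \<in> loopfree V d r m. \<exists>i<m. w ` block r i \<in> M}) \<le> 4 * real d * real r / card V * card (loopfree V d r m)"
proof -
  interpret conflict_model V d "m * r" r "row_graph r m"
    by unfold_locales (use assms conflict_graph_row_graph[of m r] in auto)
  have F: "loopfree V d r m = F" by (rule loopfree_eq_avoiding)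
  have np: "real (card V) > 0" "real r > 0" "real d > 0" using n r d by auto
  have N': "real m * real r = real d * real (card V)" using N by (metis of_nat_mult)
  define p where "p v = (THE e. e \<in> M \<and> v \<in> e)" for v
  have p: "p v \<in> M" if "v \<in> V" for v using theI'[OF M(2)[OF that]] by (simp add: p_def)
  have p_eq: "p v = e" if "e \<in> M" "v \<in> e" for v e
  proof -
    have "v \<in> V" using M(1) that by blast
    then show ?thesis unfolding p_def using that M(2) by (intro the1_equality) auto
  qed
  have "{w \<in> loopfree V d r m. \<exists>i<m. w ` block r i \<in> M} = (\<Union>i\<in>{..<m}. {w \<in> F. w ` block r i \<in> M})"
    by (auto simp: F)
  also have "real (card \<dots>) \<le> card {..<m} * ((2 * real r / card V)\<^sup>2 * card F)"
  proof (rule real_card_UN_bound)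
    fix i assume i: "i \<in> {..<m}"
    have lt: "x < m * r" if "x \<in> block r i" for x using block_subset[of i m r] i that by blast
    have "{w \<in> F. w ` block r i \<in> M} \<subseteq> {w \<in> F. w (i * r + 1) \<in> p (w (i * r)) \<and> w (i * r + 2) \<in> p (w (i * r))}"
    proof safe
      fix w assume w: "w ` block r i \<in> M"
      \<comment> \<open>A block that is an edge of \<open>M\<close> must be the edge selected by its
        first letter.\<close>
      have "p (w (i * r)) = w ` block r i" using block_three[OF r, of i] by (intro p_eq[OF w]) auto
      then show "w (i * r + 1) \<in> p (w (i * r))" "w (i * r + 2) \<in> p (w (i * r))"
        using block_three[OF r, of i] by auto
    qed
    then have "card {w \<in> F. w ` block r i \<in> M} \<le> card {w \<in> F. w (i * r + 1) \<in> p (w (i * r)) \<and> w (i * r + 2) \<in> p (w (i * r))}"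
      by (rule card_mono[rotated]) (use fin_F in auto)
    also have "real \<dots> \<le> (2 * real r / card V)\<^sup>2 * card F"
      by (rule two_in_part_prob) (use M(1)[OF p] block_three[OF r, of i] lt i r in auto)
    finally show "real (card {w \<in> F. w ` block r i \<in> M}) \<le> (2 * real r / card V)\<^sup>2 * card F" by simp
  qed simp
  also have "\<dots> = (real m * r) * 4 * r / (card V)\<^sup>2 * card F"
    by (simp add: power2_eq_square)
  also have "\<dots> = 4 * real d * real r / card V * card F"
    unfolding N' using np by (simp add: power2_eq_square)
  finally show ?thesis by (simp add: F)
qed

section \<open>Hypergraphs as words\<close>

lemma card_injections_onto:
  assumes "finite A" "finite B" "card A = card B"
  shows "card {f \<in> A \<rightarrow>\<^sub>E B. inj_on f A} = fact (card B)"
  using card_inj_on_subset_funcset[of A B A] assms by (simp add: fact_prod_rev)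

lemma inj_on_iff_image_eq:
  assumes "finite A" "finite B" "card A = card B"
  shows "f ` A \<subseteq> B \<and> inj_on f A \<longleftrightarrow> f ` A = B"
proof
  assume "f ` A \<subseteq> B \<and> inj_on f A"
  then show "f ` A = B" using assms by (intro card_subset_eq) (auto simp: card_image)
next
  assume "f ` A = B"
  then show "f ` A \<subseteq> B \<and> inj_on f A" using assms by (auto intro: eq_card_imp_inj_on)
qed

text \<open>The blocks are independent: on block \<open>i\<close> the word is any of the
  \<open>fact r\<close> bijections onto \<open>e i\<close>.\<close>

lemma card_words_with_blocks:
  assumes r: "0 < r" and V: "finite V" and e: "\<And>i. i < m \<Longrightarrow> e i \<subseteq> V \<and> card (e i) = r"
  shows "card {w \<in> {..<m * r} \<rightarrow>\<^sub>E V. \<forall>i<m. w ` block r i = e i} = fact r ^ m"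
proof -
  let ?B = "\<lambda>i. {f \<in> block r i \<rightarrow>\<^sub>E e i. inj_on f (block r i)}"
  have fin: "finite (e i)" if "i < m" for i using e[OF that] V finite_subset by blast
  have dm: "c div r < m \<and> c \<in> block r (c div r)" if "c < m * r" for c
    using that r by (simp add: div_less_iff_less_mult in_block_iff)
  have B: "f ` block r i = e i" if "f \<in> ?B i" "i < m" for f i
    using that inj_on_iff_image_eq[of "block r i" "e i" f] fin e by auto
  have bij: "bij_betw (\<lambda>w. \<lambda>i\<in>{..<m}. restrict w (block r i))
    {w \<in> {..<m * r} \<rightarrow>\<^sub>E V. \<forall>i<m. w ` block r i = e i} (PiE {..<m} ?B)"
  \<comment> \<open>The inverse glues the block functions, reading position \<open>c\<close> from
    component \<open>c div r\<close>.\<close>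
  proof (rule bij_betw_byWitness[where f' = "\<lambda>g. \<lambda>c\<in>{..<m * r}. g (c div r) c"])
    show "\<forall>w\<in>{w \<in> {..<m * r} \<rightarrow>\<^sub>E V. \<forall>i<m. w ` block r i = e i}.
       (\<lambda>c\<in>{..<m * r}. (\<lambda>i\<in>{..<m}. restrict w (block r i)) (c div r) c) = w"
    proof
      fix w assume "w \<in> {w \<in> {..<m * r} \<rightarrow>\<^sub>E V. \<forall>i<m. w ` block r i = e i}"
      then have "w \<in> extensional {..<m * r}" by (simp add: PiE_def)
      then show "(\<lambda>c\<in>{..<m * r}. (\<lambda>i\<in>{..<m}. restrict w (block r i)) (c div r) c) = w"
        using dm by (intro ext) (simp add: extensional_def restrict_def)
    qed
    show "\<forall>g\<in>PiE {..<m} ?B. (\<lambda>i\<in>{..<m}. \<lambda>c\<in>block r i. (\<lambda>c\<in>{..<m * r}. g (c div r) c) c) = g"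
    proof
      fix g assume g: "g \<in> PiE {..<m} ?B"
      show "(\<lambda>i\<in>{..<m}. \<lambda>c\<in>block r i. (\<lambda>c\<in>{..<m * r}. g (c div r) c) c) = g"
      proof (intro ext)
        fix i c
        show "(\<lambda>i\<in>{..<m}. \<lambda>c\<in>block r i. (\<lambda>c\<in>{..<m * r}. g (c div r) c) c) i c = g i c"
        proof (cases "i < m")
          case True
          then have "g i \<in> extensional (block r i)" using g by (auto simp: PiE_def)
          moreover have "c < m * r \<and> c div r = i" if "c \<in> block r i"
            using that True block_subset[of i m r] r by (auto simp: in_block_iff)
          ultimately show ?thesis using True by (auto simp: restrict_def extensional_def)
        next
          case False
          then show ?thesis using g by (auto simp: PiE_def extensional_def)
        qed
      qed
    qed
    show "(\<lambda>w. \<lambda>i\<in>{..<m}. restrict w (block r i)) ` {w \<in> {..<m * r} \<rightarrow>\<^sub>E V. \<forall>i<m. w ` block r i = e i}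
       \<subseteq> PiE {..<m} ?B"
    proof (intro image_subsetI PiE_I)
      fix w i assume w: "w \<in> {w \<in> {..<m * r} \<rightarrow>\<^sub>E V. \<forall>i<m. w ` block r i = e i}" and i: "i \<in> {..<m}"
      then have "w ` block r i \<subseteq> e i \<and> inj_on w (block r i)"
        using inj_on_iff_image_eq[of "block r i" "e i" w] fin e by auto
      then show "(\<lambda>i\<in>{..<m}. restrict w (block r i)) i \<in> ?B i" using i by auto
    qed auto
    show "(\<lambda>g. \<lambda>c\<in>{..<m * r}. g (c div r) c) ` PiE {..<m} ?B
       \<subseteq> {w \<in> {..<m * r} \<rightarrow>\<^sub>E V. \<forall>i<m. w ` block r i = e i}"
    proof (intro image_subsetI CollectI conjI PiE_I allI impI)
      fix g assume g: "g \<in> PiE {..<m} ?B"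
      have im: "g i ` block r i = e i" if "i < m" for i using B[OF _ that] g that by (auto simp: PiE_def Pi_def)
      show "(\<lambda>c\<in>{..<m * r}. g (c div r) c) ` block r i = e i" if i: "i < m" for i
      proof -
        have "(\<lambda>c\<in>{..<m * r}. g (c div r) c) ` block r i = g i ` block r i"
          by (rule image_cong) (use i block_subset[of i m r] r in \<open>auto simp: in_block_iff\<close>)
        then show ?thesis using im i by simp
      qed
      show "(\<lambda>c\<in>{..<m * r}. g (c div r) c) c \<in> V" if "c \<in> {..<m * r}" for c
        using dm[of c] im[of "c div r"] e[of "c div r"] that by auto
    qed auto
  qed
  have "card {w \<in> {..<m * r} \<rightarrow>\<^sub>E V. \<forall>i<m. w ` block r i = e i} = card (PiE {..<m} ?B)"
    by (rule bij_betw_same_card[OF bij])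
  also have "\<dots> = (\<Prod>i<m. card (?B i))" by (simp add: card_PiE)
  also have "\<dots> = (\<Prod>i<m. fact r)"
    using card_injections_onto[OF finite_block fin] e by (intro prod.cong) auto
  finally show ?thesis by simp
qed

definition blocks :: "nat \<Rightarrow> nat \<Rightarrow> (nat \<Rightarrow> 'a) \<Rightarrow> 'a set set" where
  "blocks r m w = (\<lambda>i. w ` block r i) ` {..<m}"

text \<open>The words are sorted by the enumeration of \<open>H\<close> that their blocks induce:
  \<open>fact m\<close> enumerations, each with \<open>fact r ^ m\<close> words.\<close>

lemma card_words_with_block_set:
  assumes r: "0 < r" and V: "finite V" and H: "uniform_hypergraph V r H" "finite H" "card H = m"
  shows "card {w \<in> {..<m * r} \<rightarrow>\<^sub>E V. bij_betw (\<lambda>i. w ` block r i) {..<m} H} = fact m * fact r ^ m"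
proof -
  let ?E = "{e \<in> {..<m} \<rightarrow>\<^sub>E H. inj_on e {..<m}}"
  let ?W = "\<lambda>e. {w \<in> {..<m * r} \<rightarrow>\<^sub>E V. \<forall>i<m. w ` block r i = e i}"
  have e: "e i \<subseteq> V \<and> card (e i) = r" if "e \<in> ?E" "i < m" for e i
    using that H by (auto simp: uniform_hypergraph_def PiE_def Pi_def)
  have "{w \<in> {..<m * r} \<rightarrow>\<^sub>E V. bij_betw (\<lambda>i. w ` block r i) {..<m} H} = (\<Union>e\<in>?E. ?W e)"
  proof (intro equalityI subsetI)
    fix w assume w: "w \<in> {w \<in> {..<m * r} \<rightarrow>\<^sub>E V. bij_betw (\<lambda>i. w ` block r i) {..<m} H}"
    then have "(\<lambda>i\<in>{..<m}. w ` block r i) \<in> ?E"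
      by (auto simp: bij_betw_def inj_on_def)
    moreover have "w \<in> ?W (\<lambda>i\<in>{..<m}. w ` block r i)" using w by auto
    ultimately show "w \<in> (\<Union>e\<in>?E. ?W e)" by blast
  next
    fix w assume "w \<in> (\<Union>e\<in>?E. ?W e)"
    then obtain e where e: "e \<in> ?E" "w \<in> ?W e" by blast
    have "e ` {..<m} = H"
      using e inj_on_iff_image_eq[of "{..<m}" H e] H by auto
    then have "bij_betw e {..<m} H" using e by (simp add: bij_betw_def)
    moreover have "bij_betw e {..<m} H \<longleftrightarrow> bij_betw (\<lambda>i. w ` block r i) {..<m} H"
      by (rule bij_betw_cong) (use e in auto)
    ultimately show "w \<in> {w \<in> {..<m * r} \<rightarrow>\<^sub>E V. bij_betw (\<lambda>i. w ` block r i) {..<m} H}" using e by simp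
  qed
  moreover have "card (\<Union>e\<in>?E. ?W e) = (\<Sum>e\<in>?E. card (?W e))"
  proof (rule card_UN_disjoint)
    show "finite ?E" by (rule finite_subset[of _ "{..<m} \<rightarrow>\<^sub>E H"]) (use H in \<open>auto intro: finite_PiE\<close>)
    show "\<forall>e\<in>?E. finite (?W e)"
      by (auto intro!: finite_subset[of _ "{..<m * r} \<rightarrow>\<^sub>E V"] finite_PiE V)
    show "\<forall>e\<in>?E. \<forall>e'\<in>?E. e \<noteq> e' \<longrightarrow> ?W e \<inter> ?W e' = {}"
    proof (intro ballI impI equals0I)
      fix e e' w assume "e \<in> ?E" "e' \<in> ?E" "e \<noteq> e'" and w: "w \<in> ?W e \<inter> ?W e'"
      have "e = e'"
      proof (rule PiE_ext)
        show "e \<in> PiE {..<m} (\<lambda>_. H)" "e' \<in> PiE {..<m} (\<lambda>_. H)" using \<open>e \<in> ?E\<close> \<open>e' \<in> ?E\<close> by auto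
        show "e i = e' i" if "i \<in> {..<m}" for i using w that by auto
      qed
      then show False using \<open>e \<noteq> e'\<close> by simp
    qed
  qed
  moreover have "(\<Sum>e\<in>?E. card (?W e)) = (\<Sum>e\<in>?E. fact r ^ m)"
    by (rule sum.cong[OF refl]) (rule card_words_with_blocks[OF r V e])
  moreover have "card ?E = fact m"
    using card_injections_onto[of "{..<m}" H] H by simp
  ultimately show ?thesis by simp
qed

text \<open>Sending an occurrence of \<open>v\<close> to its block is a bijection onto the edges at
  \<open>v\<close>: distinct blocks have distinct letter sets, and no block contains
  \<open>v\<close> twice.\<close>

lemma hyper_degree_blocks:
  assumes r: "0 < r" and inj: "\<And>i. i < m \<Longrightarrow> inj_on w (block r i)" "inj_on (\<lambda>i. w ` block r i) {..<m}"
  shows "hyper_degree (blocks r m w) v = card {c. c < m * r \<and> w c = v}"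
proof -
  have dm: "c div r < m \<and> c \<in> block r (c div r)" if "c < m * r" for c
    using that r by (simp add: div_less_iff_less_mult in_block_iff)
  have "bij_betw (\<lambda>c. w ` block r (c div r)) {c. c < m * r \<and> w c = v} {e \<in> blocks r m w. v \<in> e}"
    unfolding bij_betw_def
  proof (intro conjI equalityI subsetI)
    show "inj_on (\<lambda>c. w ` block r (c div r)) {c. c < m * r \<and> w c = v}"
    proof (rule inj_onI)
      fix c c' assume c: "c \<in> {c. c < m * r \<and> w c = v}" "c' \<in> {c. c < m * r \<and> w c = v}"
        "w ` block r (c div r) = w ` block r (c' div r)"
      then have "c div r = c' div r" using inj_onD[OF inj(2)] dm by auto
      then show "c = c'" using inj_onD[OF inj(1)[of "c div r"], of c c'] c dm[of c] dm[of c'] by auto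
    qed
    fix e assume "e \<in> (\<lambda>c. w ` block r (c div r)) ` {c. c < m * r \<and> w c = v}"
    then show "e \<in> {e \<in> blocks r m w. v \<in> e}" using dm by (auto simp: blocks_def)
  next
    fix e assume "e \<in> {e \<in> blocks r m w. v \<in> e}"
    then obtain i c where "i < m" "e = w ` block r i" "c \<in> block r i" "w c = v" by (auto simp: blocks_def)
    moreover from this have "c < m * r" "c div r = i" using block_subset[of i m r] r by (auto simp: in_block_iff)
    ultimately show "e \<in> (\<lambda>c. w ` block r (c div r)) ` {c. c < m * r \<and> w c = v}" by blast
  qed
  then show ?thesis
    unfolding hyper_degree_def by (rule bij_betw_same_card[symmetric])
qed

lemma finite_uniform_hypergraph: "finite V \<Longrightarrow> uniform_hypergraph V r H \<Longrightarrow> finite H"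
  by (rule finite_subset[of _ "Pow V"]) (auto simp: uniform_hypergraph_def)

text \<open>Double counting of the incidences between vertices and edges.\<close>

lemma card_edges:
  assumes V: "finite V" and H: "uniform_hypergraph V r H" "\<forall>v\<in>V. hyper_degree H v = d"
  shows "card H * r = d * card V"
proof -
  have fH: "finite H" using finite_uniform_hypergraph V H by blast
  have "(\<Sum>e\<in>H. card {v \<in> V. v \<in> e}) = d * card V"
    by (rule sum_multicount) (use V fH H in \<open>auto simp: hyper_degree_def\<close>)
  moreover have "{v \<in> V. v \<in> e} = e" if "e \<in> H" for e using H that by (auto simp: uniform_hypergraph_def)
  ultimately have "(\<Sum>e\<in>H. card e) = d * card V" by simp
  then show ?thesis using H by (simp add: uniform_hypergraph_def)
qed

text \<open>Every member of \<open>HS\<close> arises from the same number of words. The family is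
  arbitrary so that the count serves both all regular hypergraphs and those disjoint from a given
  matching.\<close>

lemma card_simple_words_blocks:
  assumes r: "0 < r" and V: "finite V" and N: "m * r = d * card V"
    and HH: "HS \<subseteq> {H. uniform_hypergraph V r H \<and> (\<forall>v\<in>V. hyper_degree H v = d)}"
  shows "card {w \<in> simple_words V d r m. blocks r m w \<in> HS} = fact m * fact r ^ m * card HS"
proof -
  let ?W = "\<lambda>H. {w \<in> {..<m * r} \<rightarrow>\<^sub>E V. bij_betw (\<lambda>i. w ` block r i) {..<m} H}"
  have finHH: "finite HS"
    by (rule finite_subset[of _ "Pow (Pow V)"]) (use HH V in \<open>auto simp: uniform_hypergraph_def\<close>)
  have H: "uniform_hypergraph V r H" "\<forall>v\<in>V. hyper_degree H v = d" "finite H" "card H = m" if "H \<in> HS" for H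
  proof -
    show 1: "uniform_hypergraph V r H" "\<forall>v\<in>V. hyper_degree H v = d" using that HH by auto
    then show "finite H" using finite_uniform_hypergraph V by blast
    show "card H = m" using card_edges[OF V 1] N r by (metis mult_right_cancel neq0_conv)
  qed
  have "{w \<in> simple_words V d r m. blocks r m w \<in> HS} = (\<Union>H\<in>HS. ?W H)"
  proof (intro equalityI subsetI)
    fix w assume "w \<in> {w \<in> simple_words V d r m. blocks r m w \<in> HS}"
    then show "w \<in> (\<Union>H\<in>HS. ?W H)"
      by (auto simp: simple_words_def loopfree_def words_def bij_betw_def blocks_def)
  next
    fix w assume "w \<in> (\<Union>H\<in>HS. ?W H)"
    then obtain K where K: "K \<in> HS" "w \<in> ?W K" by blast
    then have bl: "blocks r m w = K" and inj: "inj_on (\<lambda>i. w ` block r i) {..<m}"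
      by (auto simp: blocks_def bij_betw_def)
    \<comment> \<open>An edge has \<open>r\<close> vertices, so a block of \<open>r\<close>
      positions filling it cannot repeat a letter.\<close>
    have inj': "inj_on w (block r i)" if "i < m" for i
    proof (rule eq_card_imp_inj_on)
      have "w ` block r i \<in> K" using that bl by (auto simp: blocks_def)
      then show "card (w ` block r i) = card (block r i)"
        using H(1)[OF K(1)] by (simp add: uniform_hypergraph_def)
    qed simp
    have "card {c. c < m * r \<and> w c = v} = d" if "v \<in> V" for v
      using hyper_degree_blocks[OF r inj' inj, of v] H(2)[OF K(1)] that by (simp add: bl)
    then show "w \<in> {w \<in> simple_words V d r m. blocks r m w \<in> HS}"
      using K inj inj' bl by (auto simp: simple_words_def loopfree_def words_def)
  qed
  moreover have "card (\<Union>H\<in>HS. ?W H) = (\<Sum>H\<in>HS. card (?W H))"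
  proof (rule card_UN_disjoint[OF finHH])
    show "\<forall>H\<in>HS. finite (?W H)"
      by (auto intro!: finite_subset[of _ "{..<m * r} \<rightarrow>\<^sub>E V"] finite_PiE V)
    show "\<forall>H\<in>HS. \<forall>K\<in>HS. H \<noteq> K \<longrightarrow> ?W H \<inter> ?W K = {}"
      by (auto simp: bij_betw_def)
  qed
  moreover have "(\<Sum>H\<in>HS. card (?W H)) = (\<Sum>H\<in>HS. fact m * fact r ^ m)"
    by (rule sum.cong[OF refl]) (rule card_words_with_block_set[OF r V H(1,3,4)])
  ultimately show ?thesis by simp
qed

lemma blocks_simple_words:
  assumes r: "0 < r" and w: "w \<in> simple_words V d r m"
  shows "uniform_hypergraph V r (blocks r m w) \<and> (\<forall>v\<in>V. hyper_degree (blocks r m w) v = d)"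
proof
  have inj: "\<And>i. i < m \<Longrightarrow> inj_on w (block r i)" "inj_on (\<lambda>i. w ` block r i) {..<m}"
    and ww: "w \<in> words V d (m * r)"
    using w by (auto simp: simple_words_def loopfree_def)
  show "\<forall>v\<in>V. hyper_degree (blocks r m w) v = d"
    using hyper_degree_blocks[OF r inj] ww by (simp add: words_def)
  have "w ` block r i \<subseteq> V" if "i < m" for i
    using block_subset[OF that, of r] words_in[OF ww] by auto
  then show "uniform_hypergraph V r (blocks r m w)"
    using inj(1) by (auto simp: uniform_hypergraph_def blocks_def card_image)
qed

text \<open>A word using each letter once is injective. Hence the 1-regular hypergraphs can be
  counted exactly.\<close>

lemma simple_words_1:
  assumes "finite V" "m * r = card V" "0 < r"
  shows "simple_words V 1 r m = words V 1 (m * r)"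
proof -
  have "w \<in> simple_words V 1 r m" if w: "w \<in> words V 1 (m * r)" for w
  proof -
    have inj: "inj_on w {..<m * r}"
    proof (rule inj_onI)
      fix a b assume ab: "a \<in> {..<m * r}" "b \<in> {..<m * r}" "w a = w b"
      have "card {c. c < m * r \<and> w c = w a} = 1" using w words_in[OF w] ab by (auto simp: words_def)
      then obtain x where "{c. c < m * r \<and> w c = w a} = {x}" by (auto simp: card_1_singleton_iff)
      then show "a = b" using ab by (metis (mono_tags, lifting) lessThan_iff mem_Collect_eq singletonD)
    qed
    have "inj_on w (block r i)" if "i < m" for i using inj_on_subset[OF inj block_subset[OF that]] .
    moreover have "inj_on (\<lambda>i. w ` block r i) {..<m}"
    proof (rule inj_onI)
      fix i j assume ij: "i \<in> {..<m}" "j \<in> {..<m}" "w ` block r i = w ` block r j"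
      then have "block r i = block r j"
        using inj_on_image_eq_iff[OF inj, of "block r i" "block r j"] block_subset[of i m r] block_subset[of j m r] by simp
      moreover have "i * r \<in> block r i" using assms by (simp add: block_def)
      ultimately show "i = j" using in_block_iff[OF assms(3), of "i * r" j] assms(3) by simp
    qed
    ultimately show ?thesis using w by (simp add: simple_words_def loopfree_def)
  qed
  then show ?thesis by (auto simp: simple_words_def loopfree_def)
qed

section \<open>Perfect matchings and the expectation\<close>

lemma finite_regular_hypergraphs: "finite (regular_hypergraphs r k n)"
  by (rule finite_subset[of _ "Pow (Pow {1..n})"]) (auto simp: regular_hypergraphs_def uniform_hypergraph_def)

text \<open>Covering every vertex exactly once is 1-regularity, and \<open>card_edges\<close> then
  forces the size \<open>n div r\<close>.\<close>

lemma perfect_matching_iff: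
  assumes r: "0 < r" and H: "H \<in> regular_hypergraphs r k n"
  shows "perfect_matching {1..n} r H M \<longleftrightarrow> M \<in> regular_hypergraphs r 1 n \<and> M \<subseteq> H"
proof -
  have "(\<exists>x. S = {x}) \<longleftrightarrow> (\<exists>!e. e \<in> S)" for S :: "'b set" by blast
  from this[of "{e \<in> M. _ \<in> e}"]
  have deg: "hyper_degree M v = 1 \<longleftrightarrow> (\<exists>!e. e \<in> M \<and> v \<in> e)" for v
    by (simp add: hyper_degree_def card_1_singleton_iff)
  have "M \<in> regular_hypergraphs r 1 n \<longleftrightarrow> card M = n div r \<and> (\<forall>v\<in>{1..n}. \<exists>!e. e \<in> M \<and> v \<in> e)" if "M \<subseteq> H"
  proof -
    have u: "uniform_hypergraph {1..n} r M"
      using H that by (auto simp: regular_hypergraphs_def uniform_hypergraph_def)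
    have "card M = n div r" if "\<forall>v\<in>{1..n}. hyper_degree M v = 1"
      using card_edges[OF _ u that] r by auto
    moreover have "M \<in> regular_hypergraphs r 1 n \<longleftrightarrow> (\<forall>v\<in>{1..n}. hyper_degree M v = 1)"
      using u by (simp add: regular_hypergraphs_def)
    ultimately show ?thesis unfolding deg by blast
  qed
  then show ?thesis by (auto simp: perfect_matching_def)
qed

text \<open>Deleting \<open>M\<close> lowers every degree by one, adding a disjoint \<open>M\<close>
  raises it by one, and the two operations are mutually inverse.\<close>

lemma card_extensions_of_matching:
  assumes M: "M \<in> regular_hypergraphs r 1 n"
  shows "card {H \<in> regular_hypergraphs r (Suc d) n. M \<subseteq> H} = card {H \<in> regular_hypergraphs r d n. H \<inter> M = {}}"
proof (rule bij_betw_same_card[OF bij_betw_byWitness[where f = "\<lambda>H. H - M" and f' = "\<lambda>H. H \<union> M"]])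
  have fin: "finite H" if "H \<in> regular_hypergraphs r k n" for H k
    using that finite_uniform_hypergraph[of "{1..n}"] by (auto simp: regular_hypergraphs_def)
  have deg: "hyper_degree (H \<union> M) v = hyper_degree H v + hyper_degree M v" if "finite H" "H \<inter> M = {}" for H v
  proof -
    have "{e \<in> H \<union> M. v \<in> e} = {e \<in> H. v \<in> e} \<union> {e \<in> M. v \<in> e}" by auto
    then show ?thesis unfolding hyper_degree_def
      using that fin[OF M] by (subst card_Un_disjoint[symmetric]) auto
  qed
  show "\<forall>H\<in>{H \<in> regular_hypergraphs r (Suc d) n. M \<subseteq> H}. H - M \<union> M = H" by auto
  show "\<forall>H\<in>{H \<in> regular_hypergraphs r d n. H \<inter> M = {}}. H \<union> M - M = H" by auto
  show "(\<lambda>H. H - M) ` {H \<in> regular_hypergraphs r (Suc d) n. M \<subseteq> H} \<subseteq> {H \<in> regular_hypergraphs r d n. H \<inter> M = {}}"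
  proof (intro image_subsetI)
    fix H assume H: "H \<in> {H \<in> regular_hypergraphs r (Suc d) n. M \<subseteq> H}"
    then have "H - M \<union> M = H" by auto
    then have "hyper_degree H v = hyper_degree (H - M) v + hyper_degree M v" for v
      using deg[of "H - M" v] fin[of H "Suc d"] H by auto
    then show "H - M \<in> {H \<in> regular_hypergraphs r d n. H \<inter> M = {}}"
      using H M by (auto simp: regular_hypergraphs_def uniform_hypergraph_def)
  qed
  show "(\<lambda>H. H \<union> M) ` {H \<in> regular_hypergraphs r d n. H \<inter> M = {}} \<subseteq> {H \<in> regular_hypergraphs r (Suc d) n. M \<subseteq> H}"
  proof (intro image_subsetI)
    fix H assume H: "H \<in> {H \<in> regular_hypergraphs r d n. H \<inter> M = {}}"
    then have "hyper_degree (H \<union> M) v = hyper_degree H v + hyper_degree M v" for v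
      using deg[of H v] fin[of H d] by auto
    then show "H \<union> M \<in> {H \<in> regular_hypergraphs r (Suc d) n. M \<subseteq> H}"
      using H M by (auto simp: regular_hypergraphs_def uniform_hypergraph_def)
  qed
qed

text \<open>Pairs of a hypergraph and a perfect matching in it are counted from the side of the
  matching. Nonemptiness makes the uniform distribution meaningful.\<close>

lemma expected_perfect_matchings_eq:
  assumes r: "0 < r" and ne: "regular_hypergraphs r (Suc d) n \<noteq> {}"
  shows "expected_perfect_matchings r (Suc d) n =
    (\<Sum>M\<in>regular_hypergraphs r 1 n. real (card {H \<in> regular_hypergraphs r d n. H \<inter> M = {}}))
      / card (regular_hypergraphs r (Suc d) n)"
proof -
  let ?R = "regular_hypergraphs r (Suc d) n" and ?P = "regular_hypergraphs r 1 n"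
  have "(\<Sum>H\<in>?R. num_perfect_matchings {1..n} r H) = (\<Sum>H\<in>?R. card {M \<in> ?P. M \<subseteq> H})"
    by (rule sum.cong) (use perfect_matching_iff[OF r] in \<open>auto simp: num_perfect_matchings_def\<close>)
  also have "\<dots> = (\<Sum>M\<in>?P. card {H \<in> ?R. M \<subseteq> H})"
    by (rule sum_multicount_gen) (auto simp: finite_regular_hypergraphs)
  also have "\<dots> = (\<Sum>M\<in>?P. card {H \<in> regular_hypergraphs r d n. H \<inter> M = {}})"
    by (rule sum.cong) (use card_extensions_of_matching in auto)
  finally have "real (\<Sum>H\<in>?R. num_perfect_matchings {1..n} r H) = real (\<Sum>M\<in>?P. card {H \<in> regular_hypergraphs r d n. H \<inter> M = {}})"
    by simp
  then show ?thesis
    unfolding expected_perfect_matchings_def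
    by (subst integral_pmf_of_set[OF ne finite_regular_hypergraphs]) simp
qed

section \<open>Asymptotics\<close>

text \<open>Tends to \<open>ln (sqrt (2 * pi))\<close>. Since equally many factorials occur in the numerator and in the
  denominator below, only its rate of convergence matters.\<close>

definition stirling_remainder :: "nat \<Rightarrow> real" where
  "stirling_remainder x = ln (fact x) - (real x + 1 / 2) * ln x + x"

text \<open>The difference is \<open>(x + 1/2) * ln (1 + 1/x) - 1\<close>. The midpoint and
  trapezoidal bounds for the integral of \<open>1/t\<close> over \<open>[x, x + 1]\<close> give the
  two inequalities, the second in telescoping form.\<close>

lemma stirling_remainder_step:
  assumes "1 \<le> x"
  shows "0 \<le> stirling_remainder x - stirling_remainder (Suc x)"
    and "stirling_remainder x - stirling_remainder (Suc x) \<le> (1 / real x - 1 / real (Suc x)) / 4"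
proof -
  have x: "real x > 0" using assms by simp
  have eq: "stirling_remainder x - stirling_remainder (Suc x) = (real x + 1 / 2) * (ln (real x + 1) - ln x) - 1"
  proof -
    have "fact (Suc x) = (real x + 1) * fact x" by (simp add: add.commute)
    then have "ln (fact (Suc x) :: real) = ln (real x + 1) + ln (fact x)"
      using x by (simp only: ln_mult) (simp add: ln_mult)
    then show ?thesis
      by (simp add: stirling_remainder_def algebra_simps del: fact_Suc)
  qed
  have "ln (real x + 1) - ln x \<ge> 2 * 1 / (2 * real x + 1)"
    using ln_inverse_approx_ge[of "real x" "real x + 1"] x by (simp add: field_simps)
  then have "(real x + 1 / 2) * (ln (real x + 1) - ln x) \<ge> (real x + 1 / 2) * (2 * 1 / (2 * real x + 1))"
    using x by (intro mult_left_mono) auto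
  also have "(real x + 1 / 2) * (2 * 1 / (2 * real x + 1)) = 1" using x by (simp add: field_simps)
  finally show "0 \<le> stirling_remainder x - stirling_remainder (Suc x)" unfolding eq by simp
  have "ln (real x + 1) - ln x \<le> (1 / real x + 1 / (real x + 1)) / 2"
    using ln_inverse_approx_le[of "real x" 1] x by (simp add: field_simps)
  then have "(real x + 1 / 2) * (ln (real x + 1) - ln x) \<le> (real x + 1 / 2) * ((1 / real x + 1 / (real x + 1)) / 2)"
    using x by (intro mult_left_mono) auto
  also have "\<dots> = 1 + (1 / real x - 1 / (real x + 1)) / 4"
  proof -
    have "(y + 1 / 2) * ((a + b) / 2) = 1 + (a - b) / 4" if "a * y = 1" "b * (y + 1) = 1" for a b y :: real
    proof -
      have "(y + 1 / 2) * ((a + b) / 2) = (2 * (a * y) + a + 2 * (b * (y + 1)) - b) / 4"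
        by (simp add: field_simps)
      also have "\<dots> = 1 + (a - b) / 4" unfolding that by (simp add: field_simps)
      finally show ?thesis .
    qed
    then show ?thesis using x by simp
  qed
  finally show "stirling_remainder x - stirling_remainder (Suc x) \<le> (1 / real x - 1 / real (Suc x)) / 4"
    unfolding eq of_nat_Suc by (simp only: diff_le_eq add.commute)
qed

lemma stirling_remainder_diff:
  assumes "1 \<le> a" "a \<le> b"
  shows "\<bar>stirling_remainder a - stirling_remainder b\<bar> \<le> 1 / real a"
proof -
  have "0 \<le> stirling_remainder a - stirling_remainder b \<and>
      stirling_remainder a - stirling_remainder b \<le> (1 / real a - 1 / real b) / 4"
    using assms(2)
  proof (induction b rule: dec_induct)
    case (step b)
    then show ?case using stirling_remainder_step[of b] assms(1) by (simp add: diff_divide_distrib)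
  qed simp
  moreover have "(1 / real a - 1 / real b) / 4 \<le> 1 / real a"
    using assms by (simp add: field_simps)
  ultimately show ?thesis by linarith
qed

text \<open>The factorials pair up as those of \<open>c * q\<close> and \<open>c * n\<close> for
  \<open>c\<close> equal to 1, \<open>d\<close> and \<open>k\<close>, and each pair of remainders
  contributes at most \<open>1 / q\<close>. The linear terms cancel because
  \<open>k = d + 1\<close>; the half logarithms leave \<open>ln r / 2\<close>, the source of
  \<open>sqrt r\<close>.\<close>

lemma stirling_ratio:
  assumes "1 \<le> q" "1 \<le> r" "1 \<le> d" "k = Suc d" "n = q * r"
  shows "\<bar>ln (fact n * fact (k * q) * fact (d * n) * real k ^ n / (fact q * fact (d * q) * fact (k * n)))
     - (ln (sqrt r) + q * (ln k + (real r - 1) * d * (ln d - ln k)))\<bar> \<le> 3 / q"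
proof -
  have pos: "real q > 0" "real r > 0" "real d > 0" "real k > 0" using assms by auto
  have L: "ln (fact x :: real) = stirling_remainder x + (real x + 1 / 2) * ln x - x" for x
    by (simp add: stirling_remainder_def)
  have diff: "\<bar>stirling_remainder (c * q) - stirling_remainder (c * n)\<bar> \<le> 1 / q" if "1 \<le> c" for c
  proof -
    have "c * q \<le> c * n" using assms by simp
    moreover have "1 \<le> c * q" using assms that by simp
    ultimately have "\<bar>stirling_remainder (c * q) - stirling_remainder (c * n)\<bar> \<le> 1 / real (c * q)"
      using stirling_remainder_diff by blast
    also have "\<dots> \<le> 1 / q" using pos that by (simp add: field_simps)
    finally show ?thesis .
  qed
  have "ln (fact n * fact (k * q) * fact (d * n) * real k ^ n / (fact q * fact (d * q) * fact (k * n)))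
    = ln (fact n) + ln (fact (k * q)) + ln (fact (d * n)) + n * ln k - (ln (fact q) + ln (fact (d * q)) + ln (fact (k * n)))"
    using pos by (simp add: ln_mult ln_div ln_realpow)
  also have "\<dots> = (stirling_remainder (1 * n) - stirling_remainder (1 * q)) + (stirling_remainder (k * q) - stirling_remainder (k * n))
     + (stirling_remainder (d * n) - stirling_remainder (d * q)) + (ln (sqrt r) + q * (ln k + (real r - 1) * d * (ln d - ln k)))"
  proof -
    have "ln (sqrt r) = ln r / 2" using pos by (simp add: ln_sqrt)
    moreover have "ln (real (c * q)) = ln c + ln q" "ln (real (c * n)) = ln c + ln q + ln r" if "1 \<le> c" for c
      using pos that by (simp_all add: assms(5) ln_mult)
    note this[of 1] this[of k] this[of d]
    moreover have "ln (real (Suc 0)) = 0" by simp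
    moreover have "real n = real q * real r" "real (c * q) = real c * real q"
        "real (c * n) = real c * (real q * real r)" for c
      by (simp_all add: assms(5))
    \<comment> \<open>Hides \<open>ln k\<close>, so that rewriting \<open>k\<close> as
      \<open>d + 1\<close> does not reach into the logarithm.\<close>
    moreover define K where "K = ln (real k)"
    moreover have "real k = real d + 1" using assms by simp
    ultimately show ?thesis
      unfolding L K_def[symmetric] using assms(1-4) by (simp add: algebra_simps add_divide_distrib del: of_nat_mult of_nat_Suc)
  qed
  finally show ?thesis
    using diff[of 1] diff[of k] diff[of d] assms by (simp add: abs_le_iff)
qed

section \<open>Combining the counts into the expectation\<close>

lemma word_count_ratio:
  assumes V: "finite V"
  shows "card (words V d (d * card V)) / card (words V (Suc d) (Suc d * card V))
    = fact (d * card V) * real (Suc d) ^ card V / fact (Suc d * card V)"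
proof -
  have 1: "real (card (words V d (d * card V))) * fact d ^ card V = fact (d * card V)" for d
    using arg_cong[OF card_words[OF V refl, of d], of real] by simp
  have 2: "real (card (words V d (d * card V))) = fact (d * card V) / fact d ^ card V" for d
    using 1[of d] by (simp add: field_simps)
  show ?thesis
    unfolding 2[of d] 2[of "Suc d"] by (simp add: power_mult_distrib del: mult_Suc of_nat_Suc)
qed

text \<open>Replacing simple words by loop-free ones overestimates numerator and denominator of the
  expectation, each by a relative error at most \<eta>; \<open>X\<close> is the quotient after both
  replacements.\<close>

lemma expected_perfect_matchings_sandwich:
  assumes r: "3 \<le> r" and d: "1 \<le> d" and n: "n = q * r" "100 * r \<le> n"
    and \<eta>: "\<eta> = 12 * (real (Suc d))\<^sup>2 * r / n" "\<eta> \<le> 1 / 2"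
  defines "X \<equiv> fact n * fact (Suc d * q) / (fact q * fact (d * q)) *
      (card (loopfree {1..n} d r (d * q)) / card (loopfree {1..n} (Suc d) r (Suc d * q)))"
  shows "(1 - \<eta>) * X \<le> expected_perfect_matchings r (Suc d) n"
    and "expected_perfect_matchings r (Suc d) n \<le> X / (1 - \<eta>)"
    and "0 < X"
proof -
  let ?V = "{1..n}" and ?k = "Suc d"
  let ?a = "real (card (loopfree ?V d r (d * q)))" and ?A = "real (card (loopfree ?V ?k r (?k * q)))"
  let ?R = "\<lambda>k. regular_hypergraphs r k n"
  have r0: "0 < r" and np: "real n > 0" using r n by auto
  have N: "k * q * r = k * card ?V" for k using n by simp
  have n': "100 * r \<le> card ?V" using n by simp
  have kge: "1 \<le> ?k" by simp
  have r2: "2 \<le> r" using r by simp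
  have ap: "?a > 0"
    using loopfree_estimate(1)[OF _ N d r2 n'] finite_loopfree[of ?V] by (simp add: card_gt_0_iff)
  have Ap: "?A > 0"
    using loopfree_estimate(1)[OF _ N kge r2 n'] finite_loopfree[of ?V] by (simp add: card_gt_0_iff)
  then show X0: "0 < X" using ap by (simp add: X_def)
  have reg: "?R k \<subseteq> {H. uniform_hypergraph ?V r H \<and> (\<forall>v\<in>?V. hyper_degree H v = k)}" for k
    by (auto simp: regular_hypergraphs_def)
  have bl: "blocks r m w \<in> ?R k" if "w \<in> simple_words ?V k r m" for w k m
    using blocks_simple_words[OF r0 that] by (simp add: regular_hypergraphs_def)
  have sl: "simple_words ?V k r m \<subseteq> loopfree ?V k r m" for k m by (auto simp: simple_words_def)

  have cR: "card (simple_words ?V k r (k * q)) = fact (k * q) * fact r ^ (k * q) * card (?R k)" for k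
  proof -
    have "{w \<in> simple_words ?V k r (k * q). blocks r (k * q) w \<in> ?R k} = simple_words ?V k r (k * q)"
      using bl by auto
    moreover have "card {w \<in> simple_words ?V k r (k * q). blocks r (k * q) w \<in> ?R k} = fact (k * q) * fact r ^ (k * q) * card (?R k)"
      by (rule card_simple_words_blocks[OF r0 _ N reg]) simp
    ultimately show ?thesis by (simp only:)
  qed
  have cR': "real (card (simple_words ?V k r (k * q))) = card (?R k) * (fact (k * q) * fact r ^ (k * q))" for k
    unfolding cR by simp
  have card_simple: "real (card (simple_words ?V k r (k * q))) \<ge> (1 - 8 * (real k)\<^sup>2 * real r / n) * card (loopfree ?V k r (k * q))"
    if k: "1 \<le> k" for k
  proof -
    have "card (loopfree ?V k r (k * q) - simple_words ?V k r (k * q)) =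
       card (loopfree ?V k r (k * q)) - card (simple_words ?V k r (k * q))"
      using sl finite_loopfree[of ?V] finite_subset[OF sl] by (intro card_Diff_subset) auto
    moreover have "card (simple_words ?V k r (k * q)) \<le> card (loopfree ?V k r (k * q))"
      using sl finite_loopfree[of ?V] by (intro card_mono) auto
    ultimately have "real (card (loopfree ?V k r (k * q) - simple_words ?V k r (k * q))) =
       real (card (loopfree ?V k r (k * q))) - real (card (simple_words ?V k r (k * q)))"
      by simp
    then show ?thesis
      using repeated_rows_bound[OF _ N k r n'] by (simp add: algebra_simps)
  qed

  \<comment> \<open>The number of perfect matchings on the vertex set is known exactly, so it adds
    no error.\<close>
  have R1: "real (card (?R 1)) * (fact q * fact r ^ q) = fact n"
  proof -
    have "card (simple_words ?V 1 r (1 * q)) = card (words ?V 1 n)"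
      using simple_words_1[OF _ _ r0, of ?V q] n(1)[symmetric] by simp
    also have "\<dots> = fact n" using card_words[of ?V n 1] by simp
    finally have "fact q * fact r ^ q * card (?R 1) = fact n"
      using cR[of 1] by (simp only: mult_1)
    then have "real (fact q * fact r ^ q * card (?R 1)) = real (fact n)" by (simp only:)
    then show ?thesis by (simp add: mult_ac)
  qed

  have Rk: "(1 - \<eta>) * ?A \<le> card (?R ?k) * (fact (?k * q) * fact r ^ (?k * q))"
    "card (?R ?k) * (fact (?k * q) * fact r ^ (?k * q)) \<le> ?A"
  proof -
    have "(1 - \<eta>) * ?A \<le> (1 - 8 * (real ?k)\<^sup>2 * real r / n) * ?A"
    proof (intro mult_right_mono diff_left_mono)
      show "8 * (real ?k)\<^sup>2 * real r / n \<le> \<eta>"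
        unfolding \<eta> by (intro divide_right_mono mult_right_mono) auto
    qed auto
    also have "\<dots> \<le> real (card (simple_words ?V ?k r (?k * q)))" by (rule card_simple) simp
    also have "\<dots> = card (?R ?k) * (fact (?k * q) * fact r ^ (?k * q))" by (rule cR')
    finally show "(1 - \<eta>) * ?A \<le> card (?R ?k) * (fact (?k * q) * fact r ^ (?k * q))" .
    have "real (card (simple_words ?V ?k r (?k * q))) \<le> ?A"
      using sl finite_loopfree[of ?V] by (intro of_nat_mono card_mono) auto
    then show "card (?R ?k) * (fact (?k * q) * fact r ^ (?k * q)) \<le> ?A" unfolding cR' .
  qed

  have RM: "(1 - \<eta>) * ?a \<le> card {H \<in> ?R d. H \<inter> M = {}} * (fact (d * q) * fact r ^ (d * q))"
    "card {H \<in> ?R d. H \<inter> M = {}} * (fact (d * q) * fact r ^ (d * q)) \<le> ?a" if M: "M \<in> ?R 1" for M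
  proof -
    let ?S = "{w \<in> simple_words ?V d r (d * q). blocks r (d * q) w \<in> {H \<in> ?R d. H \<inter> M = {}}}"
    let ?bad = "{w \<in> loopfree ?V d r (d * q). \<exists>i<d * q. w ` block r i \<in> M}"
    have cS: "card ?S = fact (d * q) * fact r ^ (d * q) * card {H \<in> ?R d. H \<inter> M = {}}"
      by (rule card_simple_words_blocks[OF r0 _ N]) (use reg[of d] in auto)
    have S': "real (card ?S) = card {H \<in> ?R d. H \<inter> M = {}} * (fact (d * q) * fact r ^ (d * q))"
      unfolding cS by simp
    have "?S \<subseteq> loopfree ?V d r (d * q)" using sl by auto
    then show "card {H \<in> ?R d. H \<inter> M = {}} * (fact (d * q) * fact r ^ (d * q)) \<le> ?a"
      unfolding S'[symmetric] using finite_loopfree[of ?V] by (intro of_nat_mono card_mono) auto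
    have "real (card ?bad) \<le> 4 * real d * real r / card ?V * ?a"
    proof (rule matching_rows_bound[OF _ N d r n'])
      show "e \<subseteq> ?V \<and> card e = r" if "e \<in> M" for e
        using M that by (auto simp: regular_hypergraphs_def uniform_hypergraph_def)
      have "(\<exists>x. S = {x}) \<longleftrightarrow> (\<exists>!e. e \<in> S)" for S :: "nat set set" by blast
      from this[of "{e \<in> M. _ \<in> e}"]
      show "\<exists>!e. e \<in> M \<and> v \<in> e" if "v \<in> ?V" for v
        using M that by (auto simp: regular_hypergraphs_def hyper_degree_def card_1_singleton_iff)
    qed simp
    then have bad: "real (card ?bad) \<le> 4 * real d * real r / n * ?a" by simp
    \<comment> \<open>A simple word outside \<open>?S\<close> gives a \<open>d\<close>-regular
      hypergraph sharing an edge with \<open>M\<close>, so one of its blocks is that edge.\<close>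
    have "simple_words ?V d r (d * q) \<subseteq> ?S \<union> ?bad"
      using bl[of _ d "d * q"] sl by (auto simp: blocks_def)
    then have "card (simple_words ?V d r (d * q)) \<le> card (?S \<union> ?bad)"
      using finite_loopfree[of ?V d r "d * q"] finite_subset[OF sl[of d "d * q"]] by (intro card_mono) auto
    also have "\<dots> \<le> card ?S + card ?bad" by (rule card_Un_le)
    finally have "real (card (simple_words ?V d r (d * q))) \<le> real (card ?S) + real (card ?bad)" by linarith
    then have "real (card ?S) \<ge> (1 - 8 * (real d)\<^sup>2 * real r / n) * ?a - 4 * real d * real r / n * ?a"
      using card_simple[OF d] bad by linarith
    also have "(1 - 8 * (real d)\<^sup>2 * real r / n) * ?a - 4 * real d * real r / n * ?a
       = (1 - (8 * (real d)\<^sup>2 + 4 * real d) * real r / n) * ?a"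
      by (simp add: algebra_simps add_divide_distrib)
    finally have "(1 - (8 * (real d)\<^sup>2 + 4 * real d) * real r / n) * ?a \<le> card ?S" .
    moreover have "(1 - \<eta>) * ?a \<le> (1 - (8 * (real d)\<^sup>2 + 4 * real d) * real r / n) * ?a"
    proof (intro mult_right_mono diff_left_mono)
      \<comment> \<open>The losses from repeated blocks and from edges of \<open>M\<close> are both
        absorbed in the constant 12 of \<eta>.\<close>
      have "8 * (real d)\<^sup>2 + 4 * real d \<le> 12 * (real ?k)\<^sup>2"
        by (simp add: power2_eq_square algebra_simps)
      then show "(8 * (real d)\<^sup>2 + 4 * real d) * real r / n \<le> \<eta>"
        unfolding \<eta> by (intro divide_right_mono mult_right_mono) auto
    qed auto
    ultimately show "(1 - \<eta>) * ?a \<le> card {H \<in> ?R d. H \<inter> M = {}} * (fact (d * q) * fact r ^ (d * q))"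
      using S' by linarith
  qed

  define B :: real where "B = fact (d * q) * fact r ^ (d * q)"
  define C :: real where "C = fact (?k * q) * fact r ^ (?k * q)"
  define D :: real where "D = fact q * fact r ^ q"
  define Y where "Y = (\<Sum>M\<in>?R 1. real (card {H \<in> ?R d. H \<inter> M = {}}))"
  have BCD: "B > 0" "C > 0" "D > 0" by (simp_all add: B_def C_def D_def)
  have Rkp: "real (card (?R ?k)) > 0"
  proof -
    have "0 < (1 - \<eta>) * ?A" using \<eta>(2) Ap by simp
    also have "\<dots> \<le> card (?R ?k) * C" using Rk(1) by (simp add: C_def)
    finally show ?thesis using BCD by (simp add: zero_less_mult_iff)
  qed
  then have E: "expected_perfect_matchings r ?k n = Y / card (?R ?k)"
    unfolding Y_def by (intro expected_perfect_matchings_eq[OF r0]) auto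
  \<comment> \<open>The powers of \<open>fact r\<close> cancel because
    \<open>q + d * q = Suc d * q\<close>.\<close>
  have X: "X = (fact n / D) * (?a / B) / (?A / C)"
    by (simp add: X_def B_def C_def D_def power_add field_simps)
  have R1': "real (card (?R 1)) = fact n / D" using R1 BCD by (simp add: D_def field_simps)
  have Y1: "Y \<le> card (?R 1) * (?a / B)"
    unfolding Y_def using RM(2) BCD by (intro sum_bounded_above) (simp add: B_def field_simps)
  have Y2: "card (?R 1) * ((1 - \<eta>) * ?a / B) \<le> Y"
    unfolding Y_def using RM(1) BCD by (intro sum_bounded_below) (simp add: B_def field_simps)
  have K1: "(1 - \<eta>) * ?A / C \<le> card (?R ?k)" and K2: "card (?R ?k) \<le> ?A / C"
    using Rk BCD by (simp_all add: C_def field_simps)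
  have "(1 - \<eta>) * X = card (?R 1) * ((1 - \<eta>) * ?a / B) / (?A / C)"
    unfolding X R1' by simp
  also have "\<dots> \<le> Y / card (?R ?k)"
    by (rule frac_le[OF _ Y2 Rkp K2]) (simp add: Y_def sum_nonneg)
  finally show "(1 - \<eta>) * X \<le> expected_perfect_matchings r (Suc d) n" by (simp add: E)
  have "Y / card (?R ?k) \<le> card (?R 1) * (?a / B) / ((1 - \<eta>) * ?A / C)"
    by (rule frac_le[OF _ Y1 _ K1]) (use \<eta>(2) Ap BCD ap in auto)
  also have "\<dots> = X / (1 - \<eta>)" unfolding X R1' by simp
  finally show "expected_perfect_matchings r (Suc d) n \<le> X / (1 - \<eta>)" by (simp add: E)
qed

text \<open>The factor 1000 ensures \<open>100 * r \<le> n\<close> and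
  \<open>\<eta> \<le> 1 / 2\<close>. The errors of the sandwich, of Stirling's formula and of the
  two loop-free estimates have coefficients 24, 3, 5 and 5, which sum to less than 50.\<close>

theorem expected_perfect_matchings_estimate:
  assumes r: "3 \<le> r" and k: "2 \<le> k" and n: "r dvd n" "0 < n" "1000 * (real r ^ 4 * real k ^ 2) \<le> n"
  defines "g \<equiv> sqrt r * (real k * ((real k - 1) / real k) ^ ((r - 1) * (k - 1))) ^ (n div r)"
  shows "expected_perfect_matchings r k n > 0" and "g > 0"
    and "\<bar>ln (expected_perfect_matchings r k n / g) - (real r - 1) / 2\<bar> \<le> 50 * (real r ^ 4 * real k ^ 2 / n)"
proof -
  define d q where "d = k - 1" and "q = n div r"
  have dk: "k = Suc d" "1 \<le> d" using k by (auto simp: d_def)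
  have nq: "n = q * r" using n by (simp add: q_def)
  have q1: "1 \<le> q" using n nq by (cases q) auto
  have pos: "real k > 0" "real r > 0" "real n > 0" "real q > 0" "real d > 0" using k r n q1 dk by auto
  have rk: "real r \<ge> 3" "real k \<ge> 2" using r k by auto
  have r1: "real r ^ i \<ge> 1" "real k ^ i \<ge> 1" for i using rk by (simp_all add: one_le_power)
  have b1: "real r \<le> real r ^ 4 * real k ^ 2"
    using mult_mono[OF power_increasing[of 1 4 "real r"] r1(2)[of 2]] rk by simp
  have b2: "(real k)\<^sup>2 * r \<le> real r ^ 4 * real k ^ 2"
    using power_increasing[of 1 4 "real r"] rk by (simp add: mult.commute mult_right_mono)
  have b3: "real k * (real r)\<^sup>2 \<le> real r ^ 4 * real k ^ 2"
    using mult_mono[OF power_increasing[of 2 4 "real r"] power_increasing[of 1 2 "real k"]] rk by (simp add: mult.commute)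
  have "real (100 * r) \<le> real n" using b1 n(3) by simp
  then have n100: "100 * r \<le> n" by linarith
  define \<eta> where "\<eta> = 12 * (real k)\<^sup>2 * r / n"
  have "12 * (real k)\<^sup>2 * r \<le> n / 2" using b2 n(3) by simp
  then have \<eta>2: "\<eta> \<le> 1 / 2" using pos by (simp add: \<eta>_def field_simps)
  have \<eta>0: "0 \<le> \<eta>" by (simp add: \<eta>_def)
  let ?a = "real (card (loopfree {1..n} d r (d * q)))" and ?A = "real (card (loopfree {1..n} k r (k * q)))"
  let ?w = "real (card (words {1..n} d (d * q * r)))" and ?W = "real (card (words {1..n} k (k * q * r)))"
  let ?E = "expected_perfect_matchings r k n"
  define X where "X = fact n * fact (k * q) / (fact q * fact (d * q)) * (?a / ?A)"
  have "\<eta> = 12 * (real (Suc d))\<^sup>2 * r / n" by (simp only: \<eta>_def dk(1))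
  note S = expected_perfect_matchings_sandwich[OF r dk(2) nq n100 this \<eta>2]
  have sand: "(1 - \<eta>) * X \<le> ?E" "?E \<le> X / (1 - \<eta>)" "0 < X"
    unfolding X_def dk(1) by (rule S)+
  have "0 < (1 - \<eta>) * X" using \<eta>2 sand(3) by simp
  then show Epos: "?E > 0" using sand(1) by linarith
  have "(real k - 1) / real k > 0" using k by simp
  then show gpos: "g > 0" using pos by (simp add: g_def)
  have lnE: "\<bar>ln ?E - ln X\<bar> \<le> 2 * \<eta>"
  proof -
    have "\<bar>ln (1 + - \<eta>) - (- \<eta>)\<bar> \<le> 2 * (- \<eta>)\<^sup>2"
      by (rule abs_ln_one_plus_x_minus_x_bound_nonpos) (use \<eta>0 \<eta>2 in auto)
    \<comment> \<open>Turns the quadratic error into a linear one, so that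
      \<open>ln (1 - \<eta>)\<close> is at least \<open>- 2 * \<eta>\<close>.\<close>
    moreover have "\<eta> * \<eta> \<le> 1 / 2 * \<eta>" using \<eta>0 \<eta>2 by (rule mult_right_mono[rotated])
    ultimately have l: "ln (1 - \<eta>) \<ge> - 2 * \<eta>" by (simp add: power2_eq_square)
    have "ln ((1 - \<eta>) * X) \<le> ln ?E" using sand \<eta>2 by (intro ln_mono) auto
    moreover have "ln ?E \<le> ln (X / (1 - \<eta>))" using sand \<eta>2 Epos by (intro ln_mono) auto
    ultimately show ?thesis using sand(3) \<eta>2 l by (simp add: ln_mult ln_div)
  qed
  have N: "c * q * r = c * card {1..n}" for c using nq by simp
  have r2: "2 \<le> r" and n': "100 * r \<le> card {1..n}" and k1: "1 \<le> k" using r n100 k by auto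
  have Sd: "\<bar>ln (?a / ?w) + (real r - 1) * (real d - 1) / 2\<bar> \<le> 5 * real d * (real r)\<^sup>2 / n"
    using loopfree_estimate(2)[OF _ N dk(2) r2 n'] by simp
  have Sk: "\<bar>ln (?A / ?W) + (real r - 1) * (real k - 1) / 2\<bar> \<le> 5 * real k * (real r)\<^sup>2 / n"
    using loopfree_estimate(2)[OF _ N k1 r2 n'] by simp
  have cpos: "?a > 0" "?A > 0" "?w > 0" "?W > 0"
  proof -
    show a: "?a > 0" using loopfree_estimate(1)[OF _ N dk(2) r2 n'] finite_loopfree[of "{1..n}"] by (simp add: card_gt_0_iff)
    show A: "?A > 0" using loopfree_estimate(1)[OF _ N k1 r2 n'] finite_loopfree[of "{1..n}"] by (simp add: card_gt_0_iff)
    have "loopfree {1..n} c r (c * q) \<subseteq> words {1..n} c (c * q * r)" for c by (auto simp: loopfree_def)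
    then have "card (loopfree {1..n} c r (c * q)) \<le> card (words {1..n} c (c * q * r))" for c
      by (intro card_mono finite_words) auto
    then show "?w > 0" "?W > 0" using a A by (metis of_nat_0_less_iff order.strict_trans2)+
  qed
  have wW: "?w / ?W = fact (d * n) * real k ^ n / fact (k * n)"
    using word_count_ratio[of "{1..n}" d] by (simp add: dk(1) nq mult.assoc del: mult_Suc fact_Suc of_nat_Suc)
  let ?T = "fact n * fact (k * q) * fact (d * n) * real k ^ n / (fact q * fact (d * q) * fact (k * n))"
  \<comment> \<open>Inserting the numbers of all words splits \<open>X\<close> into a quotient of
    factorials and powers and the two probabilities of being loop-free.\<close>
  have "X = ?T * ((?a / ?w) / (?A / ?W))"
  proof -
    have "X = fact n * fact (k * q) / (fact q * fact (d * q)) * (?w / ?W) * ((?a / ?w) / (?A / ?W))"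
      using cpos by (simp add: X_def)
    then show ?thesis unfolding wW by simp
  qed
  then have lnX: "ln X = ln ?T + ln (?a / ?w) - ln (?A / ?W)"
    using cpos pos by (simp add: ln_mult ln_div)
  have T: "\<bar>ln ?T - (ln (sqrt r) + q * (ln k + (real r - 1) * d * (ln d - ln k)))\<bar> \<le> 3 / q"
    by (rule stirling_ratio) (use q1 r dk nq in auto)
  have lng: "ln g = ln (sqrt r) + q * (ln k + (real r - 1) * d * (ln d - ln k))"
  proof -
    have "real k - 1 = real d" using dk by simp
    moreover have "real (r - 1) = real r - 1" using r by (simp add: of_nat_diff)
    ultimately show ?thesis
      using pos dk(2) by (simp add: g_def ln_mult ln_div ln_realpow flip: q_def d_def)
  qed
  \<comment> \<open>The loop-free exponents for \<open>k\<close> and \<open>d\<close> differ by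
    exactly the exponent \<open>(r - 1) / 2\<close> of the result.\<close>
  have "(real r - 1) * (real k - 1) / 2 - (real r - 1) * (real d - 1) / 2 = (real r - 1) / 2"
    by (simp add: dk(1) algebra_simps diff_divide_distrib add_divide_distrib)
  moreover have "ln (?E / g) = ln ?E - ln g" using Epos gpos by (simp add: ln_div)
  ultimately have "\<bar>ln (?E / g) - (real r - 1) / 2\<bar> \<le> 2 * \<eta> + 3 / q + 5 * real d * (real r)\<^sup>2 / n + 5 * real k * (real r)\<^sup>2 / n"
    using lnE lnX T Sd Sk unfolding lng by linarith
  also have "\<dots> = (24 * ((real k)\<^sup>2 * r) + 3 * real r + 5 * (real d * (real r)\<^sup>2) + 5 * (real k * (real r)\<^sup>2)) / n"
    using pos by (simp add: \<eta>_def nq field_simps)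
  also have "\<dots> \<le> 50 * (real r ^ 4 * real k ^ 2) / n"
  proof (rule divide_right_mono)
    have "real d * (real r)\<^sup>2 \<le> real k * (real r)\<^sup>2" by (simp add: dk(1) mult_right_mono)
    moreover have "0 \<le> real r ^ 4 * real k ^ 2" by simp
    ultimately show "24 * ((real k)\<^sup>2 * r) + 3 * real r + 5 * (real d * (real r)\<^sup>2) + 5 * (real k * (real r)\<^sup>2)
       \<le> 50 * (real r ^ 4 * real k ^ 2)"
      using b1 b2 b3 by linarith
  qed simp
  finally show "\<bar>ln (?E / g) - (real r - 1) / 2\<bar> \<le> 50 * (real r ^ 4 * real k ^ 2 / n)" by simp
qed

theorem corollary3p1:
  fixes r k :: "nat \<Rightarrow> nat"
  assumes "\<And>n. n \<ge> 3 \<Longrightarrow> r n \<ge> 3"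
    and "\<And>n. n \<ge> 3 \<Longrightarrow> k n \<ge> 2"
    and "infinite {n. r n dvd n}"
    and "(\<lambda>n. real (r n) ^ 4 * real (k n) ^ 2) \<in> o[at_top_divisible r](\<lambda>n. real n)"
  shows "\<exists>\<epsilon> :: nat \<Rightarrow> real.
           \<epsilon> \<in> O[at_top_divisible r](\<lambda>n. real (r n) ^ 4 * real (k n) ^ 2 / real n) \<and>
           (\<forall>\<^sub>F n in at_top_divisible r.
              expected_perfect_matchings (r n) (k n) n =
                sqrt (real (r n)) *
                (real (k n) * ((real (k n) - 1) / real (k n)) ^ ((r n - 1) * (k n - 1))) ^ (n div r n) *
                exp ((real (r n) - 1) / 2 + \<epsilon> n))"
proof -
  define g where "g n = sqrt (real (r n)) *
      (real (k n) * ((real (k n) - 1) / real (k n)) ^ ((r n - 1) * (k n - 1))) ^ (n div r n)" for n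
  \<comment> \<open>The exact logarithmic deviation, so the claimed identity holds wherever the
    expectation and \<open>g\<close> are positive.\<close>
  define \<epsilon> where "\<epsilon> n = ln (expected_perfect_matchings (r n) (k n) n / g n) - (real (r n) - 1) / 2" for n
  have "\<forall>\<^sub>F n in at_top_divisible r. r n dvd n \<and> 3 \<le> n"
    unfolding at_top_divisible_def eventually_inf_principal
    using eventually_ge_at_top[of "3 :: nat"] by (rule eventually_mono) simp
  \<comment> \<open>The constant matches the factor 1000 in
    \<open>expected_perfect_matchings_estimate\<close>.\<close>
  moreover have "\<forall>\<^sub>F n in at_top_divisible r. norm (real (r n) ^ 4 * real (k n) ^ 2) \<le> 1 / 1000 * norm (real n)"
    using landau_o.smallD[OF assms(4), of "1 / 1000"] by simp
  ultimately have main: "\<forall>\<^sub>F n in at_top_divisible r.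
      expected_perfect_matchings (r n) (k n) n > 0 \<and> g n > 0 \<and>
      \<bar>\<epsilon> n\<bar> \<le> 50 * (real (r n) ^ 4 * real (k n) ^ 2 / n)"
  proof eventually_elim
    case (elim n)
    then have "3 \<le> r n" "2 \<le> k n" "r n dvd n" "0 < n" "1000 * (real (r n) ^ 4 * real (k n) ^ 2) \<le> n"
      using assms(1,2) by auto
    from expected_perfect_matchings_estimate[OF this] show ?case
      by (simp add: g_def \<epsilon>_def)
  qed
  show ?thesis
  proof (intro exI conjI)
    show "\<epsilon> \<in> O[at_top_divisible r](\<lambda>n. real (r n) ^ 4 * real (k n) ^ 2 / real n)"
      by (rule bigoI[of _ 50]) (use main in eventually_elim, simp)
    show "\<forall>\<^sub>F n in at_top_divisible r.
              expected_perfect_matchings (r n) (k n) n =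
                sqrt (real (r n)) *
                (real (k n) * ((real (k n) - 1) / real (k n)) ^ ((r n - 1) * (k n - 1))) ^ (n div r n) *
                exp ((real (r n) - 1) / 2 + \<epsilon> n)"
      using main
    proof eventually_elim
      case (elim n)
      then have "expected_perfect_matchings (r n) (k n) n = g n * exp ((real (r n) - 1) / 2 + \<epsilon> n)"
        by (simp add: \<epsilon>_def)
      then show ?case by (simp only: g_def)
    qed
  qed
qed

end
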